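(* As $n\to\infty$, locally uniformly for $z$ in $S_1=\{z\in\mathbb{C}:\mathrm{Re}(z)>-1\}$, $$\log \mathbb{E}\left[e^{z\log|\det W_n^{H}|}\right]=z\,\mu_n^{H}+\frac{z^2}{4}\log\left(\frac n2\right)+\Upsilon^{H}(z)+o(1),$$ where $$\Upsilon^H(z):=\log\left(\frac{\Gamma\left(\frac12\right)}{\Gamma\left(\frac{z+1}{2}\right)}\,\frac{G\left(\frac12\right)^2}{G\left(\frac{z+1}{2}\right)^2}\right),\qquad \mu_n^{H}:=\frac12\log 2\pi-\frac n2+\frac n2\log n .$$
   Context: $W_n^H$ is a random $n\times n$ Hermitian matrix of the Gaussian Unitary Ensemble, normalized so that its eigenvalues have joint density on $\mathbb{R}^n$ proportional to $\prod_{1\le j<k\le n}|\lambda_k-\lambda_j|^2\prod_{k=1}^n e^{-\lambda_k^2/2}$. $G$ is the Barnes $G$-function, i.e. the entire function with $G(1)=1$, $G(z+1)=G(z)\Gamma(z)$, $G(1+z)=(2\pi)^{z/2}e^{-(z+1)z/2}\prod_{j\ge1}\left\{(1+\frac zj)^j(1+\frac1j)^{z^2/2}e^{-z}\right\}$. Logarithms of the non-vanishing analytic functions of $z$ on $S_1$ are the analytic branches vanishing at $z=0$. *)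

theory Defs
  imports
    "HOL-Complex_Analysis.Complex_Analysis"
    "HOL-Probability.Probability"
    "Jordan_Normal_Form.Schur_Decomposition"
begin

text \<open>The off-diagonal coordinates of a Hermitian matrix are stored as the real parts above and the
  imaginary parts below the diagonal; together with the (real) diagonal they are \<open>n\<^sup>2\<close> independent
  real coordinates. Since the imaginary parts are centred Gaussians, it does not matter that the
  entries below the diagonal are the conjugates of those above it.\<close>

definition hermitian_coord :: "complex mat \<Rightarrow> nat \<times> nat \<Rightarrow> real" where
  "hermitian_coord A = (\<lambda>(i, j). if i \<le> j then Re (A $$ (i, j)) else Im (A $$ (i, j)))"

text \<open>The Gaussian Unitary Ensemble up to scale: \<open>\<sigma>\<close> is left free here, because the scale is fixed
  through the eigenvalue density below. The law of the matrix has a density proportional to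
  \<open>exp (- trace (H\<^sup>2) / (2 * \<sigma>\<^sup>2))\<close> on the space of Hermitian matrices.\<close>

definition gaussian_unitary_ensemble ::
    "'a measure \<Rightarrow> nat \<Rightarrow> real \<Rightarrow> ('a \<Rightarrow> complex mat) \<Rightarrow> bool" where
  "gaussian_unitary_ensemble M n \<sigma> W \<longleftrightarrow>
     prob_space M \<and> \<sigma> > 0 \<and>
     (\<forall>\<omega>\<in>space M. W \<omega> \<in> carrier_mat n n \<and> mat_adjoint (W \<omega>) = W \<omega>) \<and>
     prob_space.indep_vars M (\<lambda>_. borel) (\<lambda>p \<omega>. hermitian_coord (W \<omega>) p) ({..<n} \<times> {..<n}) \<and>
     (\<forall>i<n. \<forall>j<n. distributed M lborel (\<lambda>\<omega>. hermitian_coord (W \<omega>) (i, j))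
        (\<lambda>x. ennreal (normal_density 0 (if i = j then \<sigma> else \<sigma> / sqrt 2) x)))"

text \<open>For a Hermitian matrix the roots of the characteristic polynomial are real, so taking real
  parts loses nothing.\<close>

definition eigenvalue_list :: "complex mat \<Rightarrow> real list" where
  "eigenvalue_list A = sorted_list_of_multiset (image_mset Re (proots (char_poly A)))"

text \<open>A density on all of \<open>\<real>\<^sup>n\<close>, rather than on the ordered chamber, refers to the eigenvalues listed
  in exchangeable order. The probability space is therefore enlarged by an independent, uniformly
  distributed permutation that shuffles the sorted eigenvalues.\<close>

definition eigenvalues_have_joint_density ::
    "'a measure \<Rightarrow> nat \<Rightarrow> ('a \<Rightarrow> complex mat) \<Rightarrow> ((nat \<Rightarrow> real) \<Rightarrow> real) \<Rightarrow> bool" where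
  "eigenvalues_have_joint_density M n W p \<longleftrightarrow>
     distributed (M \<Otimes>\<^sub>M uniform_count_measure {\<pi>. \<pi> permutes {..<n}})
       (\<Pi>\<^sub>M i\<in>{..<n}. lborel)
       (\<lambda>(\<omega>, \<pi>). \<lambda>i\<in>{..<n}. eigenvalue_list (W \<omega>) ! \<pi> i)
       (\<lambda>x. ennreal (p x))"

definition normalized_GUE :: "'a measure \<Rightarrow> nat \<Rightarrow> ('a \<Rightarrow> complex mat) \<Rightarrow> bool" where
  "normalized_GUE M n W \<longleftrightarrow>
     (\<exists>\<sigma>. gaussian_unitary_ensemble M n \<sigma> W) \<and>
     (\<exists>c>0. eigenvalues_have_joint_density M n W
        (\<lambda>x. c * (\<Prod>k<n. \<Prod>j<k. \<bar>x k - x j\<bar>\<^sup>2) * (\<Prod>k<n. exp (- (x k)\<^sup>2 / 2))))"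

text \<open>The product formula is the one for \<open>G (1 + w)\<close>, taken at \<open>w = z - 1\<close>; the factor with index
  \<open>j\<close> of the library product is the one for \<open>Suc j\<close>.\<close>

definition barnes_G :: "complex \<Rightarrow> complex" where
  "barnes_G z = (let w = z - 1 in
     of_real (2 * pi) powr (w / 2) * exp (- (w + 1) * w / 2) *
     (\<Prod>j. (1 + w / of_nat (Suc j)) ^ Suc j *
           (1 + 1 / of_nat (Suc j)) powr (w\<^sup>2 / 2) * exp (- w)))"

definition analytic_log :: "complex set \<Rightarrow> (complex \<Rightarrow> complex) \<Rightarrow> complex \<Rightarrow> complex" where
  "analytic_log S f =
     (SOME L. L holomorphic_on S \<and> L 0 = 0 \<and> (\<forall>z\<in>S. exp (L z) = f z))"

text \<open>On a connected set the choice is immaterial.\<close>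

lemma analytic_log_eqI:
  assumes S: "connected S" "0 \<in> S"
    and L: "L holomorphic_on S" "L 0 = 0" "\<And>z. z \<in> S \<Longrightarrow> exp (L z) = f z"
    and z: "z \<in> S"
  shows "analytic_log S f z = L z"
proof -
  let ?P = "\<lambda>L. L holomorphic_on S \<and> L 0 = 0 \<and> (\<forall>z\<in>S. exp (L z) = f z)"
  define A where "A = analytic_log S f"
  have "?P A"
    unfolding A_def analytic_log_def by (rule someI[of ?P L]) (use L in auto)
  hence A: "A holomorphic_on S" "A 0 = 0" "\<And>z. z \<in> S \<Longrightarrow> exp (A z) = f z"
    by auto
  define g where "g = (\<lambda>z. A z - L z)"
  have g: "\<exists>k::int. g z = of_int (2 * k) * (of_real pi * \<i>)" if "z \<in> S" for z
  proof -
    have "exp (A z) = exp (L z)" using A L that by simp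
    then obtain k :: int where "A z = L z + of_int (2 * k) * of_real pi * \<i>"
      unfolding exp_eq by auto
    thus ?thesis by (auto simp: g_def mult.assoc)
  qed
  have cont: "continuous_on S g"
    unfolding g_def using A L by (intro holomorphic_on_imp_continuous_on holomorphic_on_diff)
  have "g constant_on S"
  proof (rule continuous_discrete_range_constant[OF S(1) cont])
    fix x assume x: "x \<in> S"
    have "2 * pi \<le> norm (g y - g x)" if y: "y \<in> S" "g y \<noteq> g x" for y
    proof -
      obtain k l :: int where k: "g x = of_int (2 * k) * (of_real pi * \<i>)"
        and l: "g y = of_int (2 * l) * (of_real pi * \<i>)"
        using g[OF x] g[OF y(1)] by auto
      have "l \<noteq> k" using k l y(2) by auto
      hence "1 \<le> \<bar>l - k\<bar>" by linarith
      hence 1: "1 \<le> \<bar>of_int (l - k) :: real\<bar>"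
        by (metis of_int_1_le_iff of_int_abs)
      have "g y - g x = of_real (2 * pi * of_int (l - k)) * \<i>"
        unfolding k l by (simp add: algebra_simps)
      hence "norm (g y - g x) = 2 * pi * \<bar>of_int (l - k)\<bar>"
        by (simp only: norm_mult norm_of_real norm_ii) (simp add: abs_mult)
      thus ?thesis using mult_left_mono[OF 1, of "2 * pi"] by simp
    qed
    thus "\<exists>e>0. \<forall>y. y \<in> S \<and> g y \<noteq> g x \<longrightarrow> e \<le> norm (g y - g x)"
      by (intro exI[of _ "2 * pi"]) auto
  qed
  hence "g z = g 0" using S(2) z unfolding constant_on_def by metis
  thus ?thesis using A(2) L(2) by (simp add: g_def A_def)
qed

definition S1 :: "complex set" where
  "S1 = {z. Re z > - 1}"

definition Upsilon_H :: "complex \<Rightarrow> complex" where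
  "Upsilon_H = analytic_log S1 (\<lambda>z.
     Gamma (1 / 2) / Gamma ((z + 1) / 2) * ((barnes_G (1 / 2))\<^sup>2 / (barnes_G ((z + 1) / 2))\<^sup>2))"

definition mu_H :: "nat \<Rightarrow> real" where
  "mu_H n = 1 / 2 * ln (2 * pi) - real n / 2 + real n / 2 * ln (real n)"

end

theory Submission
  imports Defs "HOL-Real_Asymp.Real_Asymp"
begin

text \<open>
  The Mellin transform \<open>E s\<close> of \<open>\<bar>det W\<bar>\<close>, that is the expectation of \<open>\<bar>det W\<bar>\<close> to the power
  \<open>s\<close>, is known exactly for every \<open>n\<close>; the asymptotics follow by comparing the exact formula with
  the infinite products for \<open>Gamma\<close> and for the Barnes function \<open>G\<close>.

  Exact formula. Since \<open>\<bar>det W\<bar>\<close> is the product of the absolute values of the eigenvalues, \<open>E s\<close> is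
  the integral of \<open>c * V(x)\<^sup>2\<close> against the product weight with factors
  \<open>\<rho>(t) = \<bar>t\<bar>\<^sup>s * exp (- t\<^sup>2 / 2)\<close>, where \<open>V\<close> is the Vandermonde product. The latter is the
  determinant of \<open>p\<^sub>j(x\<^sub>i)\<close> for any monic polynomials \<open>p\<^sub>j\<close> of degree \<open>j\<close>
  (\<open>prod_diff_eq_det\<close>). If these are orthogonal for the bilinear pairing with weight \<open>\<rho>\<close>, then expanding
  both determinants leaves only \<open>n!\<close> times the product of the self-pairings
  (\<open>integral_prod_diff_squared\<close>). The pairing is bilinear, not sesquilinear, so this works verbatim
  for complex \<open>s\<close>, although \<open>\<rho>\<close> is then not positive. The orthogonal polynomials are the generalized
  Hermite polynomials, with recurrence coefficients \<open>k\<close> for even \<open>k\<close> and \<open>k + s\<close> for odd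
  \<open>k\<close> (\<open>gen_hermite_orthogonal\<close>). The unknown constant \<open>c\<close> drops out on dividing by
  \<open>E 0 = 1\<close> (\<open>GUE_moment_formula\<close>).

  Asymptotics. Put \<open>w = (s - 1) / 2\<close> and \<open>N = n div 2\<close>. The logarithm of the exact formula is a
  combination of \<open>s * ln 2\<close>, of \<open>ln_Gamma (1 + w)\<close>, of \<open>P = (\<Sum>j\<le>N. ln (1 + w / j))\<close> and of
  \<open>Q = (\<Sum>j\<le>N. j * ln (1 + w / j))\<close>, minus the same expression at \<open>s = 0\<close>. Here \<open>Q\<close> is, up to
  explicit terms, a partial sum of the logarithm of the product for \<open>G (1 + w)\<close>, so it converges
  after renormalization; and \<open>ln_Gamma (1 + w) + P - w * ln (N + 1)\<close> is a tail of Euler's product for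
  \<open>Gamma\<close>. That tail enters with the factor \<open>n + 1\<close>, hence is needed up to \<open>o(1 / N)\<close>: it equals
  \<open>(w\<^sup>2 - w) / (2 * N + 2)\<close> up to \<open>O(1 / N\<^sup>2)\<close> (\<open>Gamma_tail_approx\<close>). With these two inputs the
  difference to the claimed expansion is an explicit sum of terms that tend to \<open>0\<close> uniformly on
  compact sets (\<open>log_moment_error\<close>, \<open>log_moment_asymptotics\<close>).

  Both logarithms in the claim are therefore given by explicit holomorphic functions on the
  half-plane that vanish at \<open>0\<close>, and these agree with the chosen analytic branches because the
  half-plane is connected.
\<close>

section \<open>Squared Vandermonde products and orthogonal polynomials\<close>

text \<open>
  Replacing \<open>x\<^sub>n\<close> in the last row by an indeterminate turns the determinant into a polynomial \<open>Q\<close> of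
  degree at most \<open>n\<close>, by expansion along that row. It vanishes at the other nodes, where two rows
  coincide, and its coefficient of degree \<open>n\<close> is the determinant of size \<open>n\<close>. Over distinct nodes this
  determines \<open>Q\<close>; if two of the first \<open>n\<close> nodes coincide, both sides vanish.
\<close>

lemma prod_diff_eq_det:
  fixes p :: "nat \<Rightarrow> 'a :: idom poly"
  assumes monic: "\<And>j. degree (p j) = j" "\<And>j. lead_coeff (p j) = 1"
  shows "(\<Prod>k<n. \<Prod>j<k. x k - x j) = Determinant.det (mat n n (\<lambda>(i, j). poly (p j) (x i)))"
proof (induction n)
  case 0
  thus ?case by simp
next
  case (Suc n)
  define V where "V = (\<Prod>k<n. \<Prod>j<k. x k - x j)"
  define A where "A = mat (Suc n) (Suc n) (\<lambda>(i, j). poly (p j) (x i))"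
  have A: "A \<in> carrier_mat (Suc n) (Suc n)" by (simp add: A_def)
  define c where "c = (\<lambda>j. cofactor A n j)"
  define Q where "Q = (\<Sum>j<Suc n. Polynomial.smult (c j) (p j))"
  have detA: "Determinant.det A = poly Q (x n)"
    using laplace_expansion_row[OF A, of n]
    by (simp add: Q_def c_def A_def poly_sum mult.commute)
  have cn: "c n = V"
  proof -
    have "mat_delete A n n = mat n n (\<lambda>(i, j). poly (p j) (x i))"
      by (intro eq_matI) (auto simp: A_def mat_delete_def)
    thus ?thesis using Suc.IH by (simp add: c_def cofactor_def V_def)
  qed
  have root: "poly Q (x i) = 0" if i: "i < n" for i
  proof -
    define B where "B = mat (Suc n) (Suc n) (\<lambda>(k, j). poly (p j) (if k = n then x i else x k))"
    have B: "B \<in> carrier_mat (Suc n) (Suc n)" by (simp add: B_def)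
    have del: "mat_delete B n j = mat_delete A n j" if "j < Suc n" for j
      using that by (intro eq_matI) (auto simp: A_def B_def mat_delete_def)
    have "Determinant.det B = poly Q (x i)"
      using laplace_expansion_row[OF B, of n] del
      by (simp add: Q_def c_def B_def cofactor_def poly_sum mult.commute)
    moreover have "Determinant.det B = 0"
      by (rule det_identical_rows[OF B, of i n]) (use i in \<open>auto simp: B_def intro!: eq_vecI\<close>)
    ultimately show ?thesis by simp
  qed
  have goal: "V * (\<Prod>j<n. x n - x j) = Determinant.det A"
  proof (cases "inj_on x {..<n}")
    case True
    define R where "R = Q - Polynomial.smult V (\<Prod>j<n. [:- x j, 1:])"
    have lin: "degree (\<Prod>j<n. [:- x j, 1:]) = n" "lead_coeff (\<Prod>j<n. [:- x j, 1:]) = 1"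
      by (subst degree_prod_eq_sum_degree) (auto simp: lead_coeff_prod)
    have "R = 0"
    proof (rule ccontr)
      assume R: "R \<noteq> 0"
      have coeff_p: "coeff (p j) m = 0" if "m > j" for m j
        using that monic(1)[of j] by (simp add: coeff_eq_0)
      have "degree R < n \<or> R = 0"
      proof -
        have high: "coeff R m = 0" if m: "m \<ge> n" for m
        proof -
          have "coeff Q m = c n * coeff (p n) m"
            unfolding Q_def using m coeff_p by (simp add: coeff_sum)
          also have "\<dots> = V * coeff (\<Prod>j<n. [:- x j, 1:]) m"
          proof (cases "m = n")
            case True
            thus ?thesis using monic[of n] lin cn by simp
          next
            case False
            hence "m > n" using m by simp
            thus ?thesis using coeff_p[of n m] lin(1) by (simp add: coeff_eq_0)
          qed
          finally show ?thesis by (simp add: R_def)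
        qed
        show ?thesis using R high by (metis leI leading_coeff_0_iff)
      qed
      hence deg: "degree R < n" using R by simp
      have "x ` {..<n} \<subseteq> {t. poly R t = 0}"
        using root by (auto simp: R_def poly_prod)
      hence "card (x ` {..<n}) \<le> card {t. poly R t = 0}"
        by (intro card_mono poly_roots_finite R)
      also have "\<dots> \<le> degree R" by (rule card_poly_roots_bound[OF R])
      finally show False using deg True by (simp add: card_image)
    qed
    hence "poly Q (x n) = V * (\<Prod>j<n. x n - x j)"
      by (simp add: R_def poly_prod)
    thus ?thesis using detA by simp
  next
    case False
    then obtain i j where ij: "i < n" "j < n" "i \<noteq> j" "x i = x j"
      by (auto simp: inj_on_def)
    have "Determinant.det A = 0"
      by (rule det_identical_rows[OF A, of i j]) (use ij in \<open>auto simp: A_def intro!: eq_vecI\<close>)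
    moreover have "V = 0"
    proof -
      define a b where "a = max i j" and "b = min i j"
      have ab: "a < n" "b < a" "x a = x b" using ij by (auto simp: a_def b_def max_def min_def)
      have "(\<Prod>j<a. x a - x j) = 0" using ab by (intro prod_zero) auto
      thus ?thesis unfolding V_def using ab by (intro prod_zero) auto
    qed
    ultimately show ?thesis by simp
  qed
  thus ?case by (simp add: V_def A_def)
qed

text \<open>
  In the double Leibniz expansion the term of \<open>\<sigma>\<close> and \<open>\<tau>\<close> factors into one-dimensional integrals
  of the products of \<open>w\<close> with the polynomials of index \<open>\<sigma> i\<close> and \<open>\<tau> i\<close>. Orthogonality kills it unless \<open>\<sigma> = \<tau>\<close>, and each of the \<open>n!\<close>
  diagonal terms has sign \<open>1\<close> and contributes the product of all \<open>h k\<close>.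
\<close>

lemma integral_prod_diff_squared:
  fixes p :: "nat \<Rightarrow> complex poly" and w :: "real \<Rightarrow> complex"
  assumes monic: "\<And>j. degree (p j) = j" "\<And>j. lead_coeff (p j) = 1"
    and int: "\<And>i j. integrable lborel (\<lambda>t. poly (p i) (of_real t) * poly (p j) (of_real t) * w t)"
    and orth: "\<And>i j. (\<integral>t. poly (p i) (of_real t) * poly (p j) (of_real t) * w t \<partial>lborel)
                 = (if i = j then h i else 0)"
  shows "(\<integral>x. (\<Prod>k<n. \<Prod>j<k. of_real (x k) - of_real (x j))\<^sup>2 * (\<Prod>k<n. w (x k)) \<partial>(\<Pi>\<^sub>M i\<in>{..<n}. lborel))
         = fact n * (\<Prod>k<n. h k)"
proof -
  interpret product_sigma_finite "\<lambda>_ :: nat. lborel :: real measure" by standard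
  define S where "S = {\<sigma>. \<sigma> permutes {..<n}}"
  have finS: "finite S" unfolding S_def by (rule finite_permutations) simp
  define f where "f = (\<lambda>(\<sigma> :: nat \<Rightarrow> nat) (\<tau> :: nat \<Rightarrow> nat) i t. poly (p (\<sigma> i)) (of_real t) * poly (p (\<tau> i)) (of_real t) * w t)"
  define e where "e = (\<lambda>\<sigma> :: nat \<Rightarrow> nat. signof \<sigma> :: complex)"
  have expand: "(\<Prod>k<n. \<Prod>j<k. of_real (x k) - of_real (x j))\<^sup>2 * (\<Prod>k<n. w (x k))
      = (\<Sum>\<sigma>\<in>S. \<Sum>\<tau>\<in>S. e \<sigma> * e \<tau> * (\<Prod>i<n. f \<sigma> \<tau> i (x i)))" for x :: "nat \<Rightarrow> real"
  proof -
    have "(\<Prod>k<n. \<Prod>j<k. of_real (x k) - of_real (x j)) = (\<Sum>\<sigma>\<in>S. e \<sigma> * (\<Prod>i<n. poly (p (\<sigma> i)) (of_real (x i))))"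
      unfolding prod_diff_eq_det[OF monic, of "\<lambda>k. of_real (x k)"] S_def e_def
        det_def'[OF mat_carrier] atLeast0LessThan
    proof (intro sum.cong refl arg_cong2[where f = times] prod.cong)
      fix \<sigma> i assume "\<sigma> \<in> {\<sigma>. \<sigma> permutes {..<n}}" "i \<in> {..<n}"
      hence "i < n" "\<sigma> i < n" using permutes_in_image[of \<sigma> "{..<n}" i] by auto
      thus "mat n n (\<lambda>(i, j). poly (p j) (complex_of_real (x i))) $$ (i, \<sigma> i) = poly (p (\<sigma> i)) (of_real (x i))"
        by simp
    qed
    hence "(\<Prod>k<n. \<Prod>j<k. of_real (x k) - of_real (x j))\<^sup>2 * (\<Prod>k<n. w (x k))
        = (\<Sum>\<sigma>\<in>S. e \<sigma> * (\<Prod>i<n. poly (p (\<sigma> i)) (of_real (x i))))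
          * (\<Sum>\<tau>\<in>S. e \<tau> * (\<Prod>i<n. poly (p (\<tau> i)) (of_real (x i)))) * (\<Prod>k<n. w (x k))"
      by (simp only: power2_eq_square)
    also have "\<dots> = (\<Sum>\<sigma>\<in>S. \<Sum>\<tau>\<in>S. e \<sigma> * (\<Prod>i<n. poly (p (\<sigma> i)) (of_real (x i)))
             * (e \<tau> * (\<Prod>i<n. poly (p (\<tau> i)) (of_real (x i)))) * (\<Prod>k<n. w (x k)))"
      by (simp only: sum_product) (simp only: sum_distrib_right)
    also have "\<dots> = (\<Sum>\<sigma>\<in>S. \<Sum>\<tau>\<in>S. e \<sigma> * e \<tau> * (\<Prod>i<n. f \<sigma> \<tau> i (x i)))"
      by (intro sum.cong refl) (simp add: f_def prod.distrib)
    finally show ?thesis .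
  qed
  have prod_int: "(\<integral>x. (\<Prod>i<n. f \<sigma> \<tau> i (x i)) \<partial>(\<Pi>\<^sub>M i\<in>{..<n}. lborel))
      = (if \<sigma> = \<tau> then (\<Prod>k<n. h k) else 0)" if S: "\<sigma> \<in> S" "\<tau> \<in> S" for \<sigma> \<tau>
  proof -
    have "(\<integral>x. (\<Prod>i<n. f \<sigma> \<tau> i (x i)) \<partial>(\<Pi>\<^sub>M i\<in>{..<n}. lborel)) = (\<Prod>i<n. if \<sigma> i = \<tau> i then h (\<sigma> i) else 0)"
      using product_integral_prod[of "{..<n}" "f \<sigma> \<tau>"] by (simp add: f_def int orth)
    also have "\<dots> = (if \<sigma> = \<tau> then (\<Prod>k<n. h k) else 0)"
    proof (cases "\<sigma> = \<tau>")
      case True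
      thus ?thesis using prod.permute[of \<sigma> "{..<n}" h] S by (simp add: S_def o_def)
    next
      case False
      then obtain i where i: "\<sigma> i \<noteq> \<tau> i" by auto
      have "i < n"
      proof (rule ccontr)
        assume "\<not> i < n"
        hence "\<sigma> i = i" "\<tau> i = i" using S by (auto simp: S_def intro!: permutes_not_in)
        with i show False by simp
      qed
      thus ?thesis using i False by (auto intro!: prod_zero)
    qed
    finally show ?thesis .
  qed
  have prod_integrable: "integrable (\<Pi>\<^sub>M i\<in>{..<n}. lborel) (\<lambda>x. \<Prod>i<n. f \<sigma> \<tau> i (x i))" for \<sigma> \<tau>
    using product_integrable_prod[of "{..<n}" "f \<sigma> \<tau>"] by (simp add: f_def int)
  have "(\<integral>x. (\<Prod>k<n. \<Prod>j<k. of_real (x k) - of_real (x j))\<^sup>2 * (\<Prod>k<n. w (x k)) \<partial>(\<Pi>\<^sub>M i\<in>{..<n}. lborel))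
      = (\<Sum>\<sigma>\<in>S. \<Sum>\<tau>\<in>S. e \<sigma> * e \<tau> * (\<integral>x. (\<Prod>i<n. f \<sigma> \<tau> i (x i)) \<partial>(\<Pi>\<^sub>M i\<in>{..<n}. lborel)))"
    unfolding expand by (simp add: prod_integrable)
  also have "\<dots> = (\<Sum>\<sigma>\<in>S. \<Sum>\<tau>\<in>S. if \<sigma> = \<tau> then e \<sigma> * e \<tau> * (\<Prod>k<n. h k) else 0)"
    by (intro sum.cong refl) (simp add: prod_int)
  also have "\<dots> = (\<Sum>\<sigma>\<in>S. e \<sigma> * e \<sigma> * (\<Prod>k<n. h k))"
    using finS by (intro sum.cong refl) simp
  also have "\<dots> = (\<Sum>\<sigma>\<in>S. (\<Prod>k<n. h k))"
    by (intro sum.cong refl) (simp add: e_def sign_def)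
  also have "\<dots> = fact n * (\<Prod>k<n. h k)"
    unfolding S_def by (simp add: card_permutations)
  finally show ?thesis .
qed

section \<open>Generalized Hermite polynomials\<close>

definition hermite_coeff :: "complex \<Rightarrow> nat \<Rightarrow> complex" where
  "hermite_coeff s k = of_nat k + (if odd k then s else 0)"

text \<open>
  The monic orthogonal polynomials of the weight \<open>\<bar>t\<bar>\<^sup>s * exp (- t\<^sup>2 / 2)\<close>; at \<open>s = 0\<close> they are the
  Hermite polynomials in the probabilists' normalization.
\<close>

fun gen_hermite :: "complex \<Rightarrow> nat \<Rightarrow> complex poly" where
  "gen_hermite s 0 = 1"
| "gen_hermite s (Suc 0) = [:0, 1:]"
| "gen_hermite s (Suc (Suc k)) =
     pCons 0 (gen_hermite s (Suc k)) - Polynomial.smult (hermite_coeff s (Suc k)) (gen_hermite s k)"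

lemma gen_hermite_degree_lead:
  "degree (gen_hermite s k) = k \<and> lead_coeff (gen_hermite s k) = 1"
proof (induction s k rule: gen_hermite.induct)
  case (3 s k)
  let ?a = "pCons 0 (gen_hermite s (Suc k))" and ?b = "Polynomial.smult (hermite_coeff s (Suc k)) (gen_hermite s k)"
  have nz: "gen_hermite s (Suc k) \<noteq> 0" using 3 by (metis leading_coeff_0_iff zero_neq_one)
  have a: "degree ?a = Suc (Suc k)" "lead_coeff ?a = 1" using 3 nz by auto
  have b: "degree ?b < Suc (Suc k)" using 3 by (auto intro: le_less_trans[OF degree_smult_le])
  have "degree (?a - ?b) = Suc (Suc k)"
    using a b by (metis degree_add_eq_left degree_minus diff_conv_add_uminus)
  moreover have "coeff (?a - ?b) (Suc (Suc k)) = 1"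
    using a coeff_eq_0[OF b] by (metis coeff_diff diff_zero)
  ultimately show ?case by (simp only: gen_hermite.simps)
qed auto

lemma degree_gen_hermite: "degree (gen_hermite s k) = k"
  and lead_coeff_gen_hermite: "lead_coeff (gen_hermite s k) = 1"
  by (rule gen_hermite_degree_lead[THEN conjunct1], rule gen_hermite_degree_lead[THEN conjunct2])

lemma gen_hermite_parity: "coeff (gen_hermite s k) i \<noteq> 0 \<Longrightarrow> even i = even k"
proof (induction s k arbitrary: i rule: gen_hermite.induct)
  case (3 s k)
  hence "coeff (pCons 0 (gen_hermite s (Suc k))) i \<noteq> 0 \<or> coeff (gen_hermite s k) i \<noteq> 0" by auto
  thus ?case using 3(1)[of "i - 1"] 3(2)[of i] by (cases i) auto
qed (auto simp: coeff_pCons split: if_splits nat.splits)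

text \<open>
  The Dunkl operator \<open>f' (x) + s / 2 * (f x - f (- x)) / x\<close>. It plays the role of the derivative in
  the Gaussian case: it maps each generalized Hermite polynomial to a multiple of the previous one,
  and by integration by parts \<open>dunkl s f\<close> and \<open>x * f\<close> have the same integral against the weight.
\<close>

definition dunkl :: "complex \<Rightarrow> complex poly \<Rightarrow> complex poly" where
  "dunkl s f = pderiv f + Polynomial.smult (s / 2) (poly_shift 1 (f - pcompose f [:0, - 1:]))"

lemma coeff_dunkl: "coeff (dunkl s f) i = hermite_coeff s (Suc i) * coeff f (Suc i)"
  by (simp add: dunkl_def coeff_pderiv coeff_poly_shift coeff_pcompose_linear hermite_coeff_def algebra_simps)

text \<open>
  Moving the operator past multiplication by \<open>x\<close> adds \<open>f x + s * f (- x)\<close>. For the polynomial of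
  index \<open>k\<close>, which has the parity of \<open>k\<close>, this is \<open>(1 + s * (- 1)\<^sup>k) * f x\<close>, exactly the increment
  from \<open>hermite_coeff s k\<close> to \<open>hermite_coeff s (Suc k)\<close>; so the identity passes through the
  recurrence.
\<close>

lemma dunkl_gen_hermite:
  "dunkl s (gen_hermite s (Suc k)) = Polynomial.smult (hermite_coeff s (Suc k)) (gen_hermite s k)"
proof (induction s k rule: gen_hermite.induct)
  case (1 s)
  show ?case by (intro poly_eqI) (simp add: coeff_dunkl coeff_pCons hermite_coeff_def split: nat.splits)
next
  case (2 s)
  show ?case 
    by (intro poly_eqI) (auto simp: coeff_dunkl coeff_pCons hermite_coeff_def split: nat.splits)
next
  case (3 s k)
  have "coeff (dunkl s (gen_hermite s (Suc (Suc (Suc k))))) i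
     = coeff (Polynomial.smult (hermite_coeff s (Suc (Suc (Suc k)))) (gen_hermite s (Suc (Suc k)))) i" for i
  proof -
    define a where "a = coeff (gen_hermite s (Suc (Suc k))) i"
    have c1: "coeff (dunkl s (gen_hermite s (Suc (Suc k)))) j
      = hermite_coeff s (Suc (Suc k)) * coeff (gen_hermite s (Suc k)) j" for j
      using 3(1) by simp
    have c2: "hermite_coeff s (Suc i) * coeff (gen_hermite s (Suc k)) (Suc i)
      = hermite_coeff s (Suc k) * coeff (gen_hermite s k) i"
      using 3(2) coeff_dunkl[of s "gen_hermite s (Suc k)" i] by simp
    have c3: "hermite_coeff s i * a = hermite_coeff s (Suc (Suc k)) * coeff (pCons 0 (gen_hermite s (Suc k))) i"
      using c1 coeff_dunkl[of s "gen_hermite s (Suc (Suc k))"]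
      by (cases i) (auto simp: a_def hermite_coeff_def)
    have a: "a = coeff (pCons 0 (gen_hermite s (Suc k))) i - hermite_coeff s (Suc k) * coeff (gen_hermite s k) i"
      by (simp add: a_def)
    have par: "(hermite_coeff s (Suc i) - hermite_coeff s i) * a
        = (hermite_coeff s (Suc (Suc (Suc k))) - hermite_coeff s (Suc (Suc k))) * a"
      using gen_hermite_parity[of s "Suc (Suc k)" i] by (cases "a = 0") (auto simp: a_def hermite_coeff_def)
    have "coeff (dunkl s (gen_hermite s (Suc (Suc (Suc k))))) i
        = hermite_coeff s (Suc i) * a - hermite_coeff s (Suc (Suc k)) * (hermite_coeff s (Suc i) * coeff (gen_hermite s (Suc k)) (Suc i))"
      unfolding coeff_dunkl a_def gen_hermite.simps(3)[of s "Suc k"] by (simp add: algebra_simps)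
    also have "\<dots> = (hermite_coeff s (Suc i) - hermite_coeff s i) * a + hermite_coeff s i * a
         - hermite_coeff s (Suc (Suc k)) * (hermite_coeff s (Suc k) * coeff (gen_hermite s k) i)"
      unfolding c2 by (simp add: algebra_simps)
    also have "\<dots> = hermite_coeff s (Suc (Suc (Suc k))) * a"
      unfolding par c3 by (simp add: a algebra_simps)
    finally show ?thesis by (simp add: a_def)
  qed
  thus ?case by (intro poly_eqI)
qed

lemma gen_hermite_rec:
  "pCons 0 (gen_hermite s (Suc k)) = gen_hermite s (Suc (Suc k)) + Polynomial.smult (hermite_coeff s (Suc k)) (gen_hermite s k)"
  by simp

text \<open>
  Only the recursion of the moments enters, so the functional is kept abstract and \<open>s\<close> may be any
  complex number. The recursion says that \<open>L (dunkl s f) = L (x * f)\<close>. Since the recurrence reads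
  \<open>p\<^sub>k\<^sub>+\<^sub>1 = x * p\<^sub>k - dunkl s p\<^sub>k\<close>, the functional kills every \<open>p\<^sub>k\<close> with \<open>k > 0\<close>. Moving
  powers of \<open>x\<close> onto \<open>p\<^sub>k\<close> one at a time through the recurrence then gives \<open>L (x\<^sup>m * p\<^sub>k)\<close> for
  \<open>m \<le> k\<close>, and this suffices as the polynomials are monic.
\<close>

lemma gen_hermite_orthogonal:
  fixes L :: "complex poly \<Rightarrow> complex"
  assumes add: "\<And>f g. L (f + g) = L f + L g" and smult: "\<And>c f. L (Polynomial.smult c f) = c * L f"
    and mom1: "L (monom 1 (Suc 0)) = 0"
    and mom2: "\<And>m. L (monom 1 (Suc (Suc m))) = hermite_coeff s (Suc m) * L (monom 1 m)"
  shows "L (gen_hermite s i * gen_hermite s j)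
           = (if i = j then L 1 * (\<Prod>m<i. hermite_coeff s (Suc m)) else 0)"
proof -
  have L0: "L 0 = 0" using smult[of 0 0] by simp
  have Lsum: "L (\<Sum>i\<in>A. f i) = (\<Sum>i\<in>A. L (f i))" if "finite A" for f :: "nat \<Rightarrow> complex poly" and A
    using that by induction (auto simp: add L0)
  have diff: "L (f - g) = L f - L g" for f g
    using add[of "f - g" g] by simp
  have monom: "L (monom c m) = c * L (monom 1 m)" for c m
    using smult[of c "monom 1 m"] by (simp add: smult_monom)
  have D_add: "dunkl s (\<Sum>i\<in>A. f i) = (\<Sum>i\<in>A. dunkl s (f i))" for f :: "nat \<Rightarrow> complex poly" and A
    by (intro poly_eqI) (simp add: coeff_dunkl coeff_sum sum_distrib_left)
  have D_monom: "L (dunkl s (monom c m)) = L (pCons 0 (monom c m))" for c m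
  proof (cases m)
    case 0
    have "dunkl s (monom c 0) = 0" by (intro poly_eqI) (simp add: coeff_dunkl)
    thus ?thesis using 0 L0 monom[of c "Suc 0"] mom1 by (simp add: monom_Suc[symmetric])
  next
    case (Suc l)
    have "dunkl s (monom c (Suc l)) = monom (hermite_coeff s (Suc l) * c) l"
      by (intro poly_eqI) (simp add: coeff_dunkl)
    hence "L (dunkl s (monom c m)) = hermite_coeff s (Suc l) * c * L (monom 1 l)"
      using Suc by (simp only: monom[of "hermite_coeff s (Suc l) * c" l])
    also have "\<dots> = L (monom c (Suc (Suc l)))" unfolding monom[of c "Suc (Suc l)"] mom2 by simp
    finally show ?thesis using Suc by (simp add: monom_Suc)
  qed
  have by_parts: "L (dunkl s f) = L (pCons 0 f)" for f
  proof -
    have eq: "pCons 0 (\<Sum>i\<le>degree f. monom (coeff f i) i) = (\<Sum>i\<le>degree f. pCons 0 (monom (coeff f i) i))"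
      by (intro poly_eqI) (simp add: coeff_pCons coeff_sum split: nat.splits)
    have "L (dunkl s f) = L (dunkl s (\<Sum>i\<le>degree f. monom (coeff f i) i))"
      by (simp only: poly_as_sum_of_monoms)
    also have "\<dots> = (\<Sum>i\<le>degree f. L (pCons 0 (monom (coeff f i) i)))"
      by (simp only: D_add Lsum[OF finite_atMost] D_monom)
    also have "\<dots> = L (pCons 0 f)"
      by (simp only: Lsum[OF finite_atMost, symmetric] eq[symmetric] poly_as_sum_of_monoms)
    finally show ?thesis .
  qed
  have L_pos: "L (gen_hermite s (Suc k)) = 0" for k
  proof (cases k)
    case 0
    thus ?thesis using mom1 by (simp add: monom_Suc one_pCons)
  next
    case (Suc l)
    have "L (gen_hermite s (Suc (Suc l))) = L (pCons 0 (gen_hermite s (Suc l))) - L (dunkl s (gen_hermite s (Suc l)))"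
      by (simp add: diff dunkl_gen_hermite)
    thus ?thesis using Suc by_parts by simp
  qed
  define H where "H = (\<lambda>k. L 1 * (\<Prod>m<k. hermite_coeff s (Suc m)))"
  have mono_orth: "L (monom 1 m * gen_hermite s k) = (if m = k then H k else 0)" if "m \<le> k" for m k
    using that
  proof (induction m arbitrary: k)
    case 0
    show ?case by (cases k) (auto simp: L_pos H_def)
  next
    case (Suc m)
    then obtain l where l: "k = Suc l" "m \<le> l" by (cases k) auto
    have "monom 1 (Suc m) * gen_hermite s k = monom 1 m * pCons 0 (gen_hermite s k)"
      by (simp add: monom_Suc)
    also have "\<dots> = monom 1 m * gen_hermite s (Suc (Suc l)) + Polynomial.smult (hermite_coeff s (Suc l)) (monom 1 m * gen_hermite s l)"
      unfolding l gen_hermite_rec by (simp add: algebra_simps)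
    finally have "L (monom 1 (Suc m) * gen_hermite s k)
        = L (monom 1 m * gen_hermite s (Suc (Suc l))) + hermite_coeff s (Suc l) * L (monom 1 m * gen_hermite s l)"
      by (simp only: add smult)
    also have "\<dots> = (if Suc m = k then H k else 0)"
      using Suc.IH[of "Suc (Suc l)"] Suc.IH[of l] l by (simp add: H_def)
    finally show ?case .
  qed
  have le: "L (gen_hermite s i * gen_hermite s j) = (if i = j then H i else 0)" if "i \<le> j" for i j
  proof -
    have "gen_hermite s i * gen_hermite s j
        = (\<Sum>m\<le>i. monom (coeff (gen_hermite s i) m) m) * gen_hermite s j"
      using poly_as_sum_of_monoms[of "gen_hermite s i"] by (simp only: degree_gen_hermite)
    also have "\<dots> = (\<Sum>m\<le>i. Polynomial.smult (coeff (gen_hermite s i) m) (monom 1 m * gen_hermite s j))"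
      unfolding sum_distrib_right by (intro sum.cong refl) (simp add: smult_monom flip: mult_smult_left)
    finally have "L (gen_hermite s i * gen_hermite s j)
        = (\<Sum>m\<le>i. coeff (gen_hermite s i) m * L (monom 1 m * gen_hermite s j))"
      by (simp only: Lsum[OF finite_atMost] smult)
    also have "\<dots> = (\<Sum>m\<le>i. if m = j then coeff (gen_hermite s i) m * H j else 0)"
      using that by (intro sum.cong refl) (simp add: mono_orth)
    also have "\<dots> = (if i = j then H i else 0)"
      using that lead_coeff_gen_hermite[of s i] by (auto simp: degree_gen_hermite)
    finally show ?thesis .
  qed
  have "L (gen_hermite s i * gen_hermite s j) = (if i = j then H i else 0)"
    using le[of i j] le[of j i] by (cases "i \<le> j") (auto simp: mult.commute)
  thus ?thesis by (simp add: H_def)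
qed

section \<open>Moments of the weight\<close>

text \<open>
  At \<open>t = 0\<close> the value is \<open>1\<close>, because \<open>ln 0 = 0\<close>; this single point is a null set.
\<close>

definition gauss_weight :: "complex \<Rightarrow> real \<Rightarrow> complex" where
  "gauss_weight s t = exp (s * of_real (ln \<bar>t\<bar>)) * of_real (exp (- t\<^sup>2 / 2))"

definition half_moment :: "complex \<Rightarrow> complex" where
  "half_moment s = exp ((s - 1) / 2 * of_real (ln 2)) * Gamma ((s + 1) / 2)"

lemma gauss_weight_measurable [measurable]: "gauss_weight s \<in> borel_measurable borel"
  unfolding gauss_weight_def by measurable

text \<open>
  The substitution \<open>u = t\<^sup>2 / 2\<close> turns Euler's integral for \<open>Gamma ((s + 1) / 2)\<close> into this one.
\<close>

lemma half_line_integral: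
  assumes s: "Re s > - 1"
  shows "integrable lborel (\<lambda>t. indicat_real {0<..} t *\<^sub>R gauss_weight s t)"
    and "(\<integral>t. indicat_real {0<..} t *\<^sub>R gauss_weight s t \<partial>lborel) = half_moment s"
proof -
  define z where "z = (s + 1) / 2"
  have z: "Re z > 0" using s by (simp add: z_def)
  define f where "f = (\<lambda>t::real. of_real t powr (z - 1) / complex_of_real (exp t))"
  define g where "g = (\<lambda>t::real. t\<^sup>2 / 2)"
  define c where "c = exp ((s - 1) / 2 * of_real (ln 2))"
  have img: "g ` {0<..} = {0<..}"
  proof (intro equalityI subsetI)
    fix y :: real assume "y \<in> {0<..}"
    hence "y = g (sqrt (2 * y))" "sqrt (2 * y) \<in> {0<..}" by (auto simp: g_def)
    thus "y \<in> g ` {0<..}" by blast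
  qed (auto simp: g_def)
  have inj: "inj_on g {0<..}" by (auto simp: inj_on_def g_def)
  have der: "(g has_field_derivative t) (at t within {0<..})" for t
    unfolding g_def by (auto intro!: derivative_eq_intros)
  have fint: "f absolutely_integrable_on g ` {0<..}" "integral (g ` {0<..}) f = Gamma z"
    using absolutely_integrable_Gamma_integral'[OF z] integral_unique[OF Gamma_integral_complex'[OF z]]
    unfolding img f_def by auto
  have sub: "(\<lambda>t. \<bar>t\<bar> *\<^sub>R f (g t)) absolutely_integrable_on {0<..}"
      "integral {0<..} (\<lambda>t. \<bar>t\<bar> *\<^sub>R f (g t)) = Gamma z"
    using has_absolute_integral_change_of_variables_real[of "{0<..}" g "\<lambda>t. t" f "Gamma z"] der inj fint
    by auto
  have eq: "c * (\<bar>t\<bar> *\<^sub>R f (g t)) = gauss_weight s t" if "t \<in> {0<..}" for t :: real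
  proof -
    have t: "t > 0" using that by simp
    have g0: "complex_of_real (g t) \<noteq> 0" using t by (simp add: g_def)
    have "ln (g t) = 2 * ln t - ln 2" using t by (simp add: g_def ln_div ln_realpow)
    hence pw: "of_real (g t) powr (z - 1) = exp ((z - 1) * of_real (2 * ln t - ln 2))"
      using g0 Ln_of_real[of "g t"] t by (simp add: powr_def g_def)
    define a where "a = (s - 1) / 2 * complex_of_real (ln 2)"
    define b where "b = complex_of_real (ln t)"
    define e where "e = (z - 1) * complex_of_real (2 * ln t - ln 2)"
    have "complex_of_real \<bar>t\<bar> = exp (of_real (ln t))"
      using t by (metis abs_of_pos exp_ln exp_of_real)
    hence "c * (\<bar>t\<bar> *\<^sub>R f (g t)) = exp (a + b + e) * of_real (exp (- g t))"
      unfolding f_def pw scaleR_conv_of_real c_def a_def[symmetric] b_def[symmetric] e_def[symmetric]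
      by (simp add: exp_add exp_minus field_simps)
    also have "a + b + e = s * of_real (ln t)"
      by (simp add: a_def b_def e_def z_def field_simps)
    finally show ?thesis using t by (simp add: gauss_weight_def g_def)
  qed
  have "(\<lambda>t. c * (\<bar>t\<bar> *\<^sub>R f (g t))) absolutely_integrable_on {0<..}"
    using sub(1) by (rule set_integrable_mult_right)
  moreover have "(\<lambda>t. c * (\<bar>t\<bar> *\<^sub>R f (g t))) absolutely_integrable_on {0<..}
      \<longleftrightarrow> gauss_weight s absolutely_integrable_on {0<..}"
    by (intro set_integrable_cong refl eq)
  ultimately have abs: "gauss_weight s absolutely_integrable_on {0<..}" by simp
  have "integral {0<..} (gauss_weight s) = integral {0<..} (\<lambda>t. c * (\<bar>t\<bar> *\<^sub>R f (g t)))"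
    by (intro integral_cong eq[symmetric])
  also have "\<dots> = half_moment s"
    by (simp only: Henstock_Kurzweil_Integration.integral_mult_right sub(2))
       (simp only: half_moment_def c_def z_def)
  finally have val: "integral {0<..} (gauss_weight s) = half_moment s" .
  have meas: "(\<lambda>t. indicat_real {0<..} t *\<^sub>R gauss_weight s t) \<in> borel_measurable lborel" by measurable
  show "integrable lborel (\<lambda>t. indicat_real {0<..} t *\<^sub>R gauss_weight s t)"
    using abs integrable_completion[OF meas] by (simp add: set_integrable_def)
  have "(\<integral>t. indicat_real {0<..} t *\<^sub>R gauss_weight s t \<partial>lborel)
      = (LINT t:{0<..}|lebesgue. gauss_weight s t)"
    unfolding set_lebesgue_integral_def by (rule integral_completion[OF meas, symmetric])
  thus "(\<integral>t. indicat_real {0<..} t *\<^sub>R gauss_weight s t \<partial>lborel) = half_moment s"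
    using set_lebesgue_integral_eq_integral(2)[OF abs] val by simp
qed

lemma gauss_weight_power: "t > 0 \<Longrightarrow> of_real t ^ m * gauss_weight s t = gauss_weight (s + of_nat m) t"
proof -
  assume t: "t > 0"
  have "complex_of_real t ^ m = exp (of_nat m * of_real (ln t))"
    using t by (metis exp_ln exp_of_nat_mult exp_of_real)
  thus ?thesis using t by (simp add: gauss_weight_def exp_add ring_distribs)
qed

definition gauss_moment :: "complex \<Rightarrow> nat \<Rightarrow> complex" where
  "gauss_moment s m = (1 + (- 1) ^ m) * half_moment (s + of_nat m)"

text \<open>
  The weight is even, so the negative half-line contributes \<open>(- 1)\<^sup>m\<close> times the positive one, on which
  \<open>t\<^sup>m\<close> only shifts \<open>s\<close> to \<open>s + m\<close>.
\<close>

lemma gauss_moments: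
  assumes s: "Re s > - 1"
  shows "integrable lborel (\<lambda>t. of_real t ^ m * gauss_weight s t)"
    and "(\<integral>t. of_real t ^ m * gauss_weight s t \<partial>lborel) = gauss_moment s m"
proof -
  define F where "F = (\<lambda>t. indicat_real {0<..} t *\<^sub>R gauss_weight (s + of_nat m) t)"
  have sm: "Re (s + of_nat m) > - 1" using s by simp
  have F: "integrable lborel F" "(\<integral>t. F t \<partial>lborel) = half_moment (s + of_nat m)"
    unfolding F_def by (rule half_line_integral[OF sm])+
  have F': "integrable lborel (\<lambda>t. F (- t))" "(\<integral>t. F (- t) \<partial>lborel) = half_moment (s + of_nat m)"
    using lborel_integrable_real_affine[OF F(1), of "- 1" 0] lborel_integral_real_affine[of "- 1" F 0] F(2)
    by auto
  have eq: "of_real t ^ m * gauss_weight s t = F t + (- 1) ^ m * F (- t)" if "t \<noteq> 0" for t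
  proof (cases "t > 0")
    case True
    thus ?thesis using gauss_weight_power[OF True, of m s] by (simp add: F_def)
  next
    case False
    hence t: "- t > 0" using that by simp
    have "gauss_weight s t = gauss_weight s (- t)" by (simp add: gauss_weight_def)
    moreover have "complex_of_real t ^ m = (- 1) ^ m * of_real (- t) ^ m"
      by (simp flip: power_mult_distrib)
    ultimately show ?thesis using t gauss_weight_power[OF t, of m s] by (simp add: F_def)
  qed
  have ae: "AE t in lborel. F t + (- 1) ^ m * F (- t) = of_real t ^ m * gauss_weight s t"
    using AE_lborel_singleton[of 0] by eventually_elim (simp add: eq)
  have int: "integrable lborel (\<lambda>t. F t + (- 1) ^ m * F (- t))"
    using F(1) F'(1) by simp
  show "integrable lborel (\<lambda>t. of_real t ^ m * gauss_weight s t)"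
    by (rule integrable_cong_AE_imp[OF int _ ae]) measurable
  have "(\<integral>t. of_real t ^ m * gauss_weight s t \<partial>lborel) = (\<integral>t. F t + (- 1) ^ m * F (- t) \<partial>lborel)"
    using int ae by (intro integral_cong_AE) (auto simp: eq_commute)
  also have "\<dots> = gauss_moment s m"
    using F F' by (simp add: gauss_moment_def ring_distribs)
  finally show "(\<integral>t. of_real t ^ m * gauss_weight s t \<partial>lborel) = gauss_moment s m" .
qed

section \<open>The determinant of a Hermitian matrix\<close>

text \<open>
  For an eigenvector \<open>v\<close> the number \<open>S\<close>, the quadratic form of \<open>A\<close> at \<open>v\<close>, equals \<open>k\<close> times the
  squared norm \<open>N\<close> of \<open>v\<close>, and it is real because \<open>A\<close> is Hermitian.
\<close>

lemma hermitian_eigenvalue_real: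
  fixes A :: "complex mat"
  assumes A: "A \<in> carrier_mat n n" and adj: "mat_adjoint A = A" and ev: "eigenvalue A k"
  shows "Im k = 0"
proof -
  from ev A obtain v where v: "v \<in> carrier_vec n" "v \<noteq> 0\<^sub>v n" "A *\<^sub>v v = k \<cdot>\<^sub>v v"
    by (auto simp: eigenvalue_def eigenvector_def)
  have sym: "cnj (A $$ (i, j)) = A $$ (j, i)" if "i < n" "j < n" for i j
  proof -
    have "A $$ (j, i) = mat_adjoint A $$ (j, i)" by (simp add: adj)
    also have "\<dots> = cnj (A $$ (i, j))"
      using A that by (simp add: mat_adjoint_def mat_of_rows_def conjugate_complex_def)
    finally show ?thesis by simp
  qed
  define S where "S = (\<Sum>i<n. (\<Sum>j<n. A $$ (i, j) * v $ j) * cnj (v $ i))"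
  define N where "N = (\<Sum>i<n. (cmod (v $ i))\<^sup>2)"
  have row: "(\<Sum>j<n. A $$ (i, j) * v $ j) = k * v $ i" if "i < n" for i
  proof -
    have "(A *\<^sub>v v) $ i = (\<Sum>j<n. A $$ (i, j) * v $ j)"
      using A v(1) that by (simp add: scalar_prod_def atLeast0LessThan)
    thus ?thesis using v that by simp
  qed
  have "S = (\<Sum>i<n. k * v $ i * cnj (v $ i))" unfolding S_def using row by simp
  also have "\<dots> = k * of_real N"
    by (simp add: N_def sum_distrib_left mult.assoc complex_norm_square[symmetric])
  finally have SN: "S = k * of_real N" .
  have "cnj S = (\<Sum>i<n. \<Sum>j<n. A $$ (j, i) * cnj (v $ j) * v $ i)"
    unfolding S_def by (simp add: sum_distrib_right sym)
  also have "\<dots> = (\<Sum>j<n. \<Sum>i<n. A $$ (j, i) * cnj (v $ j) * v $ i)" by (rule sum.swap)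
  also have "\<dots> = S" unfolding S_def by (simp add: sum_distrib_left sum_distrib_right mult_ac)
  finally have "Im S = 0" by (metis Reals_cnj_iff complex_is_Real_iff)
  moreover have "N \<noteq> 0"
  proof
    assume "N = 0"
    hence "v $ i = 0" if "i < n" for i
      using that unfolding N_def by (subst (asm) sum_nonneg_eq_0_iff) auto
    hence "v = 0\<^sub>v n" using v(1) by (intro eq_vecI) auto
    with v(2) show False by simp
  qed
  ultimately show ?thesis unfolding SN by simp
qed

lemma length_eigenvalue_list:
  assumes "A \<in> carrier_mat n n"
  shows "length (eigenvalue_list A) = n"
proof -
  have "size (proots (char_poly A)) = n"
    using degree_monic_char_poly[OF assms] by (simp add: size_proots_complex)
  thus ?thesis by (metis eigenvalue_list_def mset_sorted_list_of_multiset size_image_mset size_mset)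
qed

text \<open>
  Up to sign, the determinant is the value at \<open>0\<close> of the characteristic polynomial, hence the product
  of its roots. These are real, so passing to their real parts in \<open>eigenvalue_list\<close> does not change
  their absolute values.
\<close>

lemma cmod_det_hermitian:
  fixes A :: "complex mat"
  assumes A: "A \<in> carrier_mat n n" and adj: "mat_adjoint A = A"
  shows "cmod (Determinant.det A) = (\<Prod>k<n. \<bar>eigenvalue_list A ! k\<bar>)"
proof -
  define P where "P = char_poly A"
  have P: "P = (\<Prod>x\<in>#proots P. [:- x, 1:])"
    using complex_poly_decompose_multiset[of P] degree_monic_char_poly[OF A] by (simp add: P_def)
  have P0: "P \<noteq> 0" using degree_monic_char_poly[OF A] by (auto simp: P_def)
  have neg: "- (char_matrix A 0) = (- 1) \<cdot>\<^sub>m A"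
    using A by (intro eq_matI) (auto simp: char_matrix_def)
  have "poly P 0 = Determinant.det ((- 1) \<cdot>\<^sub>m A)"
    using char_poly_matrix[OF A, of 0] by (simp add: P_def neg)
  hence "cmod (poly P 0) = cmod (Determinant.det A)"
    by (simp add: norm_mult norm_power)
  moreover have "cmod (poly P 0) = (\<Prod>x\<in>#proots P. cmod x)"
  proof -
    have norm_prod: "cmod (poly (\<Prod>x\<in>#X. [:- x, 1:]) 0) = (\<Prod>x\<in>#X. cmod x)" for X
      by (induction X) (simp_all add: norm_mult)
    show ?thesis by (subst P) (rule norm_prod)
  qed
  moreover have "(\<Prod>x\<in>#proots P. cmod x) = (\<Prod>x\<in>#proots P. \<bar>Re x\<bar>)"
  proof (rule arg_cong[where f = prod_mset], rule image_mset_cong)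
    fix x assume "x \<in># proots P"
    hence "poly P x = 0" using P0 by simp
    hence "eigenvalue A x" using eigenvalue_root_char_poly[OF A] by (simp add: P_def)
    hence "Im x = 0" by (rule hermitian_eigenvalue_real[OF A adj])
    thus "cmod x = \<bar>Re x\<bar>" by (simp add: cmod_eq_Re)
  qed
  moreover have "(\<Prod>x\<in>#proots P. \<bar>Re x\<bar>) = (\<Prod>k<n. \<bar>eigenvalue_list A ! k\<bar>)"
  proof -
    have "mset (map abs (eigenvalue_list A)) = image_mset (\<lambda>x. \<bar>Re x\<bar>) (proots P)"
      by (simp add: eigenvalue_list_def P_def image_mset.compositionality o_def)
    hence "(\<Prod>x\<in>#proots P. \<bar>Re x\<bar>) = prod_list (map abs (eigenvalue_list A))"
      by (metis prod_mset_prod_list)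
    also have "\<dots> = (\<Prod>k<n. \<bar>eigenvalue_list A ! k\<bar>)"
      using length_eigenvalue_list[OF A] by (simp add: prod.list_conv_set_nth atLeast0LessThan)
    finally show ?thesis .
  qed
  ultimately show ?thesis by simp
qed

section \<open>The exact Mellin transform\<close>

lemma gauss_moment_rec: 
  assumes "Re s > - 1"
  shows "gauss_moment s (Suc (Suc m)) = hermite_coeff s (Suc m) * gauss_moment s m"
proof (cases "even m")
  case True
  define z where "z = (s + of_nat m + 1) / 2"
  have "Re z > 0" using assms by (simp add: z_def add_pos_nonneg)
  hence z: "z \<notin> \<int>\<^sub>\<le>\<^sub>0" by (auto elim!: nonpos_Ints_cases)
  have "(s + of_nat (Suc (Suc m)) + 1) / 2 = z + 1" by (simp add: z_def field_simps)
  moreover have "(s + of_nat (Suc (Suc m)) - 1) / 2 * of_real (ln 2) = (s + of_nat m - 1) / 2 * complex_of_real (ln 2) + of_real (ln 2)"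
    by (simp add: field_simps)
  moreover have "exp (complex_of_real (ln 2)) = 2" by (simp add: exp_of_real)
  ultimately have "half_moment (s + of_nat (Suc (Suc m))) = 2 * z * half_moment (s + of_nat m)"
    unfolding half_moment_def using Gamma_plus1[OF z] by (simp only: exp_add) (simp add: z_def)
  moreover have "2 * z = hermite_coeff s (Suc m)"
    using True by (simp add: z_def hermite_coeff_def)
  ultimately show ?thesis by (simp only: gauss_moment_def) simp
qed (simp add: gauss_moment_def)

lemma gen_hermite_integrals:
  assumes s: "Re s > - 1"
  shows "integrable lborel (\<lambda>t. poly (gen_hermite s i) (of_real t) * poly (gen_hermite s j) (of_real t) * gauss_weight s t)"
    and "(\<integral>t. poly (gen_hermite s i) (of_real t) * poly (gen_hermite s j) (of_real t) * gauss_weight s t \<partial>lborel)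
       = (if i = j then 2 * half_moment s * (\<Prod>m<i. hermite_coeff s (Suc m)) else 0)"
proof -
  have int: "integrable lborel (\<lambda>t. poly f (of_real t) * gauss_weight s t)" for f
  proof -
    have "(\<lambda>t. poly f (of_real t) * gauss_weight s t)
        = (\<lambda>t. \<Sum>i\<le>degree f. coeff f i * (of_real t ^ i * gauss_weight s t))"
      by (simp add: poly_altdef sum_distrib_right mult.assoc)
    thus ?thesis by (simp add: gauss_moments(1)[OF s])
  qed
  define L where "L = (\<lambda>f. \<integral>t. poly f (of_real t) * gauss_weight s t \<partial>lborel)"
  have mom: "L (monom 1 m) = gauss_moment s m" for m
    using gauss_moments(2)[OF s] by (simp add: L_def poly_monom)
  have "L (gen_hermite s i * gen_hermite s j) = (if i = j then L 1 * (\<Prod>m<i. hermite_coeff s (Suc m)) else 0)"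
  proof (rule gen_hermite_orthogonal)
    show "L (f + g) = L f + L g" for f g
      using int[of f] int[of g] by (simp add: L_def ring_distribs)
    show "L (Polynomial.smult c f) = c * L f" for c f
      by (simp add: L_def mult.assoc)
    show "L (monom 1 (Suc 0)) = 0" by (simp add: mom gauss_moment_def)
    show "L (monom 1 (Suc (Suc m))) = hermite_coeff s (Suc m) * L (monom 1 m)" for m
      by (simp only: mom gauss_moment_rec[OF s])
  qed
  moreover have "L 1 = 2 * half_moment s"
    using mom[of 0] by (simp add: gauss_moment_def)
  ultimately show "(\<integral>t. poly (gen_hermite s i) (of_real t) * poly (gen_hermite s j) (of_real t) * gauss_weight s t \<partial>lborel)
       = (if i = j then 2 * half_moment s * (\<Prod>m<i. hermite_coeff s (Suc m)) else 0)"
    by (simp add: L_def)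
  show "integrable lborel (\<lambda>t. poly (gen_hermite s i) (of_real t) * poly (gen_hermite s j) (of_real t) * gauss_weight s t)"
    using int[of "gen_hermite s i * gen_hermite s j"] by simp
qed

text \<open>
  Off this null set the logarithm of the product of the \<open>\<bar>x k\<bar>\<close> is the sum of the logarithms; at
  the excluded points this can fail because of the convention \<open>ln 0 = 0\<close>.
\<close>

lemma AE_PiM_lborel_nonzero:
  fixes n :: nat
  shows "AE x in (\<Pi>\<^sub>M i\<in>{..<n}. lborel :: real measure). \<forall>k<n. x k \<noteq> 0"
proof -
  interpret product_sigma_finite "\<lambda>_ :: nat. lborel :: real measure" by standard
  have "AE x in (\<Pi>\<^sub>M i\<in>{..<n}. lborel :: real measure). x k \<noteq> 0" if k: "k < n" for k
  proof (rule AE_I)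
    define A where "A = (\<lambda>i. if i = k then {0 :: real} else UNIV)"
    show "{x \<in> space (\<Pi>\<^sub>M i\<in>{..<n}. lborel). \<not> x k \<noteq> 0} \<subseteq> Pi\<^sub>E {..<n} A"
      by (auto simp: A_def space_PiM PiE_def)
    have A: "A i \<in> sets lborel" for i by (simp add: A_def)
    show "emeasure (\<Pi>\<^sub>M i\<in>{..<n}. lborel) (Pi\<^sub>E {..<n} A) = 0"
      using emeasure_PiM[of "{..<n}" A] A k by (auto simp: A_def intro!: prod_zero bexI[of _ k])
    show "Pi\<^sub>E {..<n} A \<in> sets (\<Pi>\<^sub>M i\<in>{..<n}. lborel)"
      using A by (intro sets_PiM_I_finite) auto
  qed
  hence "AE x in (\<Pi>\<^sub>M i\<in>{..<n}. lborel :: real measure). \<forall>k\<in>{..<n}. x k \<noteq> 0"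
    by (intro AE_finite_allI) auto
  thus ?thesis by eventually_elim simp
qed

lemma density_moment:
  fixes n :: nat and c :: real
  assumes s: "Re s > - 1"
  defines "p \<equiv> \<lambda>x. c * (\<Prod>k<n. \<Prod>j<k. \<bar>x k - x j\<bar>\<^sup>2) * (\<Prod>k<n. exp (- (x k)\<^sup>2 / 2))"
  shows "(\<integral>x. p x *\<^sub>R exp (s * of_real (ln (\<Prod>k<n. \<bar>x k\<bar>))) \<partial>(\<Pi>\<^sub>M i\<in>{..<n}. lborel))
    = of_real c * fact n * (\<Prod>k<n. 2 * half_moment s * (\<Prod>m<k. hermite_coeff s (Suc m)))"
proof -
  let ?P = "\<Pi>\<^sub>M i\<in>{..<n}. lborel :: real measure"
  define q where "q = (\<lambda>x :: nat \<Rightarrow> real. (\<Prod>k<n. \<Prod>j<k. complex_of_real (x k) - of_real (x j))\<^sup>2 * (\<Prod>k<n. gauss_weight s (x k)))"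
  have eq: "p x *\<^sub>R exp (s * of_real (ln (\<Prod>k<n. \<bar>x k\<bar>))) = of_real c * q x" if x: "\<forall>k<n. x k \<noteq> 0" for x
  proof -
    have "ln (\<Prod>k<n. \<bar>x k\<bar>) = (\<Sum>k<n. ln \<bar>x k\<bar>)"
      using x by (intro ln_prod) auto
    hence e: "exp (s * of_real (ln (\<Prod>k<n. \<bar>x k\<bar>))) = (\<Prod>k<n. exp (s * of_real (ln \<bar>x k\<bar>)))"
      by (simp add: sum_distrib_left exp_sum)
    have "(\<Prod>k<n. \<Prod>j<k. \<bar>x k - x j\<bar>\<^sup>2) = (\<Prod>k<n. \<Prod>j<k. x k - x j)\<^sup>2"
      by (simp add: prod_power_distrib)
    hence "complex_of_real (p x) = of_real c * (\<Prod>k<n. \<Prod>j<k. of_real (x k) - of_real (x j))\<^sup>2 * (\<Prod>k<n. of_real (exp (- (x k)\<^sup>2 / 2)))"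
      unfolding p_def by simp
    thus ?thesis unfolding scaleR_conv_of_real e q_def gauss_weight_def prod.distrib
      by (simp only: mult_ac)
  qed
  have [measurable]: "p \<in> borel_measurable ?P" "q \<in> borel_measurable ?P"
    unfolding p_def q_def by measurable
  have "(\<integral>x. p x *\<^sub>R exp (s * of_real (ln (\<Prod>k<n. \<bar>x k\<bar>))) \<partial>?P) = (\<integral>x. of_real c * q x \<partial>?P)"
  proof (rule integral_cong_AE)
    show "AE x in ?P. p x *\<^sub>R exp (s * of_real (ln (\<Prod>k<n. \<bar>x k\<bar>))) = of_real c * q x"
      using AE_PiM_lborel_nonzero[of n] by eventually_elim (rule eq)
  qed measurable
  also have "\<dots> = of_real c * (\<integral>x. q x \<partial>?P)" by simp
  also have "(\<integral>x. q x \<partial>?P) = fact n * (\<Prod>k<n. 2 * half_moment s * (\<Prod>m<k. hermite_coeff s (Suc m)))"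
    unfolding q_def
    by (rule integral_prod_diff_squared[of "gen_hermite s"])
       (rule degree_gen_hermite lead_coeff_gen_hermite gen_hermite_integrals[OF s])+
  finally show ?thesis by (simp add: mult.assoc)
qed

text \<open>
  The product of the \<open>\<bar>x k\<bar>\<close> does not depend on the order of the eigenvalues, so the auxiliary
  random permutation disappears and the expectation over the enlarged space is the one over \<open>M\<close>.
\<close>

lemma GUE_moment_eq_density_integral:
  assumes G: "normalized_GUE M n W"
  shows "\<exists>c. \<forall>s :: complex. integral\<^sup>L M (\<lambda>\<omega>. exp (s * of_real (ln (cmod (Determinant.det (W \<omega>))))))
    = (\<integral>x. (c * (\<Prod>k<n. \<Prod>j<k. \<bar>x k - x j\<bar>\<^sup>2) * (\<Prod>k<n. exp (- (x k)\<^sup>2 / 2)))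
          *\<^sub>R exp (s * of_real (ln (\<Prod>k<n. \<bar>x k\<bar>))) \<partial>(\<Pi>\<^sub>M i\<in>{..<n}. lborel))"
proof -
  let ?P = "\<Pi>\<^sub>M i\<in>{..<n}. lborel :: real measure"
  define S where "S = {\<pi>. \<pi> permutes {..<n}}"
  define U where "U = uniform_count_measure S"
  from G obtain c where c: "c > 0" and dens: "eigenvalues_have_joint_density M n W
        (\<lambda>x. c * (\<Prod>k<n. \<Prod>j<k. \<bar>x k - x j\<bar>\<^sup>2) * (\<Prod>k<n. exp (- (x k)\<^sup>2 / 2)))"
    unfolding normalized_GUE_def by blast
  from G have W: "W \<omega> \<in> carrier_mat n n" "mat_adjoint (W \<omega>) = W \<omega>" if "\<omega> \<in> space M" for \<omega>
    using that unfolding normalized_GUE_def gaussian_unitary_ensemble_def by blast+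
  define p where "p = (\<lambda>x :: nat \<Rightarrow> real. c * (\<Prod>k<n. \<Prod>j<k. \<bar>x k - x j\<bar>\<^sup>2) * (\<Prod>k<n. exp (- (x k)\<^sup>2 / 2)))"
  have p0: "p x \<ge> 0" for x
    using c unfolding p_def by (intro mult_nonneg_nonneg prod_nonneg) auto
  have p_meas [measurable]: "p \<in> borel_measurable ?P" unfolding p_def by measurable
  define X where "X = (\<lambda>(\<omega>, \<pi>). \<lambda>i\<in>{..<n}. eigenvalue_list (W \<omega>) ! \<pi> i)"
  have X: "distr (M \<Otimes>\<^sub>M U) ?P X = density ?P (\<lambda>x. ennreal (p x))" "X \<in> measurable (M \<Otimes>\<^sub>M U) ?P"
    using dens unfolding eigenvalues_have_joint_density_def distributed_def X_def U_def S_def p_def by auto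
  have S: "finite S" "id \<in> S" unfolding S_def by (auto intro: finite_permutations permutes_id)
  interpret U: prob_space U
    unfolding U_def using S by (intro prob_space_uniform_count_measure) auto
  have "integral\<^sup>L M (\<lambda>\<omega>. exp (s * of_real (ln (cmod (Determinant.det (W \<omega>))))))
    = (\<integral>x. p x *\<^sub>R exp (s * of_real (ln (\<Prod>k<n. \<bar>x k\<bar>))) \<partial>?P)" for s :: complex
  proof -
    define g where "g = (\<lambda>x :: nat \<Rightarrow> real. exp (s * of_real (ln (\<Prod>k<n. \<bar>x k\<bar>))))"
    have g [measurable]: "g \<in> borel_measurable ?P" unfolding g_def by measurable
    define F where "F = (\<lambda>\<omega>. exp (s * of_real (ln (cmod (Determinant.det (W \<omega>))))))"
    have FX: "g (X z) = F (fst z)" if z: "z \<in> space (M \<Otimes>\<^sub>M U)" for z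
    proof -
      obtain \<omega> \<pi> where z: "z = (\<omega>, \<pi>)" "\<omega> \<in> space M" "\<pi> permutes {..<n}"
        using z by (auto simp: space_pair_measure U_def S_def space_uniform_count_measure)
      have "(\<Prod>k<n. \<bar>X z k\<bar>) = (\<Prod>k<n. \<bar>eigenvalue_list (W \<omega>) ! \<pi> k\<bar>)"
        by (simp add: X_def z(1))
      also have "\<dots> = (\<Prod>k<n. \<bar>eigenvalue_list (W \<omega>) ! k\<bar>)"
        using prod.permute[OF z(3), of "\<lambda>k. \<bar>eigenvalue_list (W \<omega>) ! k\<bar>"] by (simp add: o_def)
      also have "\<dots> = cmod (Determinant.det (W \<omega>))"
        by (rule cmod_det_hermitian[symmetric]) (use W z in auto)
      finally show ?thesis by (simp add: g_def F_def z(1))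
    qed
    have "(\<lambda>z. g (X z)) \<in> borel_measurable (M \<Otimes>\<^sub>M U)"
      using X(2) g by (rule measurable_compose)
    hence F_fst: "(\<lambda>z. F (fst z)) \<in> borel_measurable (M \<Otimes>\<^sub>M U)"
      by (rule measurable_cong[THEN iffD1, rotated]) (rule FX)
    \<comment> \<open>The density only gives measurability on the product space; a section at a fixed permutation brings it down to \<open>M\<close>.\<close>
    have "id \<in> space U" using S by (simp add: U_def space_uniform_count_measure)
    hence "(\<lambda>\<omega>. (\<omega>, id)) \<in> measurable M (M \<Otimes>\<^sub>M U)" by (rule measurable_Pair2')
    from measurable_compose[OF this F_fst] have F: "F \<in> borel_measurable M" by simp
    have "integral\<^sup>L M F = integral\<^sup>L (distr (M \<Otimes>\<^sub>M U) M fst) F"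
      by (simp only: U.distr_pair_fst)
    also have "\<dots> = (\<integral>z. F (fst z) \<partial>(M \<Otimes>\<^sub>M U))"
      by (rule integral_distr[OF measurable_fst F])
    also have "\<dots> = (\<integral>z. g (X z) \<partial>(M \<Otimes>\<^sub>M U))"
      by (rule Bochner_Integration.integral_cong) (simp_all add: FX)
    also have "\<dots> = integral\<^sup>L (distr (M \<Otimes>\<^sub>M U) ?P X) g"
      by (rule integral_distr[OF X(2) g, symmetric])
    also have "\<dots> = (\<integral>x. p x *\<^sub>R g x \<partial>?P)"
      unfolding X(1) by (rule integral_density) (auto simp: p0)
    finally show ?thesis by (simp add: F_def g_def)
  qed
  thus ?thesis unfolding p_def by blast
qed

text \<open>
  The normalizing constant of the density, together with \<open>n!\<close>, is eliminated by dividing by the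
  value at \<open>s = 0\<close>, which is the total mass \<open>1\<close>.
\<close>

lemma GUE_moment_formula:
  assumes G: "normalized_GUE M n W" and s: "Re s > - 1"
  shows "integral\<^sup>L M (\<lambda>\<omega>. exp (s * of_real (ln (cmod (Determinant.det (W \<omega>))))))
     = (\<Prod>k<n. half_moment s / half_moment 0 * (\<Prod>m<k. hermite_coeff s (Suc m) / hermite_coeff 0 (Suc m)))"
proof -
  obtain c where c: "\<And>s :: complex. integral\<^sup>L M (\<lambda>\<omega>. exp (s * of_real (ln (cmod (Determinant.det (W \<omega>))))))
    = (\<integral>x. (c * (\<Prod>k<n. \<Prod>j<k. \<bar>x k - x j\<bar>\<^sup>2) * (\<Prod>k<n. exp (- (x k)\<^sup>2 / 2)))
          *\<^sub>R exp (s * of_real (ln (\<Prod>k<n. \<bar>x k\<bar>))) \<partial>(\<Pi>\<^sub>M i\<in>{..<n}. lborel))"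
    using GUE_moment_eq_density_integral[OF G] by blast
  define E where "E = (\<lambda>s :: complex. integral\<^sup>L M (\<lambda>\<omega>. exp (s * of_real (ln (cmod (Determinant.det (W \<omega>)))))))"
  define H where "H = (\<lambda>s. \<Prod>k<n. 2 * half_moment s * (\<Prod>m<k. hermite_coeff s (Suc m)))"
  have E: "E s = of_real c * fact n * H s" if "Re s > - 1" for s
    unfolding E_def H_def c by (rule density_moment[OF that])
  interpret prob_space M
    using G unfolding normalized_GUE_def gaussian_unitary_ensemble_def by blast
  have "E 0 = 1" by (simp add: E_def prob_space)
  hence "of_real c * fact n * H 0 = 1" using E[of 0] by simp
  hence "E s = H s / H 0" using E[OF s] by (metis mult.commute mult_zero_right nonzero_eq_divide_eq zero_neq_one mult.assoc mult.right_neutral)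
  also have "H s / H 0 = (\<Prod>k<n. half_moment s / half_moment 0 * (\<Prod>m<k. hermite_coeff s (Suc m) / hermite_coeff 0 (Suc m)))"
    unfolding H_def by (simp only: prod_dividef[symmetric]) (simp add: prod_dividef)
  finally show ?thesis by (simp add: E_def)
qed

section \<open>Tails of the products for Gamma and the Barnes function\<close>

lemma Ln_approx_quadratic:
  fixes x :: complex
  assumes "norm x \<le> 1 / 2"
  shows "norm (ln (1 + x) - x + x\<^sup>2 / 2) \<le> norm x ^ 3"
proof -
  let ?f = "\<lambda>n. (-1) ^ Suc n / of_nat n * x ^ n"
  have x1: "norm x < 1" using assms by simp
  have "?f sums ln (1 + x)" using Ln_series[OF x1] by simp
  hence "(\<lambda>n. ?f (n + 3)) sums (ln (1 + x) - (\<Sum>n<3. ?f n))"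
    by (rule sums_split_initial_segment)
  moreover have "(\<Sum>n<3. ?f n) = x - x\<^sup>2 / 2"
    by (simp add: eval_nat_numeral)
  ultimately have "(\<lambda>n. ?f (n + 3)) sums (ln (1 + x) - (x - x\<^sup>2 / 2))"
    by (simp only:)
  hence sums: "(\<lambda>n. ?f (n + 3)) sums (ln (1 + x) - x + x\<^sup>2 / 2)"
    by (simp only: diff_diff_eq2 diff_add_eq)
  have geo: "(\<lambda>n. norm x ^ 3 / 3 * norm x ^ n) sums (norm x ^ 3 / 3 * (1 / (1 - norm x)))"
    by (intro sums_mult geometric_sums) (use x1 in auto)
  have le: "norm (?f (n + 3)) \<le> norm x ^ 3 / 3 * norm x ^ n" for n
  proof -
    have "norm (?f (n + 3)) = norm x ^ (n + 3) / real (n + 3)"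
      by (simp add: norm_mult norm_divide norm_power)
         (metis norm_of_nat of_nat_add of_nat_numeral)
    also have "\<dots> \<le> norm x ^ (n + 3) / 3"
      by (intro divide_left_mono) auto
    finally show ?thesis by (simp add: power_add mult_ac)
  qed
  have "norm (ln (1 + x) - x + x\<^sup>2 / 2) = norm (\<Sum>n. ?f (n + 3))"
    using sums by (simp add: sums_iff)
  also have "\<dots> \<le> (\<Sum>n. norm x ^ 3 / 3 * norm x ^ n)"
    by (rule norm_suminf_le[OF _ sums_summable[OF geo]]) (use le in auto)
  also have "\<dots> = norm x ^ 3 * (1 / (3 * (1 - norm x)))"
    using geo by (simp add: sums_iff)
  also have "\<dots> \<le> norm x ^ 3 * 1"
    using assms by (intro mult_left_mono) (auto simp: field_simps)
  finally show ?thesis by simp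
qed

definition log_prod :: "nat \<Rightarrow> complex \<Rightarrow> complex" where
  "log_prod N w = (\<Sum>j<N. ln (1 + w / of_nat (Suc j)))"

definition log_wprod :: "nat \<Rightarrow> complex \<Rightarrow> complex" where
  "log_wprod N w = (\<Sum>j<N. of_nat (Suc j) * ln (1 + w / of_nat (Suc j)))"

text \<open>
  The logarithm of the factors with index above \<open>N\<close> in Euler's product
  \<open>Gamma (1 + w) = (\<Prod>j. (1 + 1 / j) powr w / (1 + w / j))\<close>.
\<close>

definition Gamma_tail :: "nat \<Rightarrow> complex \<Rightarrow> complex" where
  "Gamma_tail N w = ln_Gamma (1 + w) + log_prod N w - w * of_real (ln (real (Suc N)))"

text \<open>
  The logarithm of the factor with index \<open>Suc j\<close> in the product for \<open>G (1 + w)\<close>. For \<open>Re w > - 1\<close>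
  the arguments of all logarithms have positive real part, so principal branches suffice.
\<close>

definition barnes_term :: "nat \<Rightarrow> complex \<Rightarrow> complex" where
  "barnes_term j w = of_nat (Suc j) * ln (1 + w / of_nat (Suc j))
     + w\<^sup>2 / 2 * of_real (ln (1 + 1 / real (Suc j))) - w"

definition log_barnes :: "complex \<Rightarrow> complex" where
  "log_barnes w = w / 2 * of_real (ln (2 * pi)) - (w + 1) * w / 2 + (\<Sum>j. barnes_term j w)"

lemma ln_1_plus_real_approx:
  fixes x :: real assumes "0 \<le> x" "x \<le> 1 / 2"
  shows "\<bar>ln (1 + x) - x\<bar> \<le> x\<^sup>2" "\<bar>ln (1 + x) - x + x\<^sup>2 / 2\<bar> \<le> x ^ 3"
proof -
  have "norm (ln (1 + complex_of_real x) - of_real x + (of_real x)\<^sup>2 / 2) \<le> norm (complex_of_real x) ^ 3"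
    using assms by (intro Ln_approx_quadratic) auto
  also have "ln (1 + complex_of_real x) - of_real x + (of_real x)\<^sup>2 / 2
      = of_real (ln (1 + x) - x + x\<^sup>2 / 2)"
    using assms Ln_of_real[of "1 + x"] by simp
  finally show 2: "\<bar>ln (1 + x) - x + x\<^sup>2 / 2\<bar> \<le> x ^ 3"
    using assms by (simp add: norm_of_real del: of_real_add of_real_diff of_real_divide of_real_power)
  have "x ^ 3 \<le> x\<^sup>2 * (1 / 2)"
    unfolding power3_eq_cube power2_eq_square using assms by (intro mult_left_mono) auto
  thus "\<bar>ln (1 + x) - x\<bar> \<le> x\<^sup>2" using 2 by linarith
qed

lemma ln_1_plus_div_approx:
  fixes w :: complex
  assumes "norm w \<le> B" "2 * B \<le> j" "0 < j"
  shows "norm (ln (1 + w / of_real j) - w / of_real j + w\<^sup>2 / of_real (2 * j\<^sup>2)) \<le> B ^ 3 / j ^ 3"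
proof -
  have n: "norm (w / of_real j) \<le> B / j"
    using assms by (simp add: norm_divide divide_right_mono)
  also have "\<dots> \<le> 1 / 2" using assms by (simp add: field_simps)
  finally have "norm (ln (1 + w / of_real j) - w / of_real j + (w / of_real j)\<^sup>2 / 2) \<le> norm (w / of_real j) ^ 3"
    by (rule Ln_approx_quadratic)
  also have "\<dots> \<le> (B / j) ^ 3" by (intro power_mono n) auto
  finally show ?thesis by (simp add: power_divide power2_eq_square mult_ac)
qed

text \<open>
  With \<open>k = Suc j\<close>, the terms of order \<open>k\<^sup>0\<close> and \<open>1 / k\<close> cancel: those of \<open>k * ln (1 + w / k)\<close> are
  \<open>w\<close> and \<open>- w\<^sup>2 / (2 * k)\<close>, and the latter is compensated by \<open>w\<^sup>2 / 2 * ln (1 + 1 / k)\<close>. The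
  remainders \<open>a\<close> and \<open>b\<close> of the two logarithms contribute \<open>O(1 / k\<^sup>2)\<close>.
\<close>

lemma norm_barnes_term_le:
  assumes w: "norm w \<le> B" and B: "1 \<le> B" "2 * B \<le> real (Suc j)"
  shows "norm (barnes_term j w) \<le> 2 * B ^ 3 * (1 / (real (Suc j))\<^sup>2)"
proof -
  define k where "k = real (Suc j)"
  have k: "k \<ge> 2" "2 * B \<le> k" using B by (auto simp: k_def)
  have kc: "of_nat (Suc j) = complex_of_real k" by (simp add: k_def)
  define a where "a = ln (1 + w / of_real k) - w / of_real k + w\<^sup>2 / of_real (2 * k\<^sup>2)"
  define b where "b = ln (1 + 1 / k) - 1 / k"
  have a: "norm a \<le> B ^ 3 / k ^ 3"
    unfolding a_def using w k by (intro ln_1_plus_div_approx) auto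
  have b: "\<bar>b\<bar> \<le> (1 / k)\<^sup>2"
    unfolding b_def using k by (intro ln_1_plus_real_approx) auto
  have "barnes_term j w = of_real k * a + w\<^sup>2 / 2 * of_real b"
    unfolding barnes_term_def kc a_def b_def k_def[symmetric] using k
    by (simp add: field_simps power2_eq_square)
  hence "norm (barnes_term j w) \<le> norm (of_real k * a) + norm (w\<^sup>2 / 2 * complex_of_real b)"
    by (simp only: norm_triangle_ineq)
  also have "norm (of_real k * a) = k * norm a" using k by (simp add: norm_mult)
  also have "\<dots> \<le> k * (B ^ 3 / k ^ 3)" using k a by (intro mult_left_mono) auto
  also have "\<dots> = B ^ 3 * (1 / k\<^sup>2)" using k by (simp add: field_simps power2_eq_square power3_eq_cube)
  also have "norm (w\<^sup>2 / 2 * complex_of_real b) = (norm w)\<^sup>2 / 2 * \<bar>b\<bar>"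
    by (simp add: norm_mult norm_divide norm_power)
  also have "\<dots> \<le> B ^ 3 * (1 / k)\<^sup>2"
  proof (rule mult_mono)
    have "(norm w)\<^sup>2 \<le> B\<^sup>2" using w by (intro power_mono) auto
    also have "\<dots> \<le> B ^ 3" using B by (intro power_increasing) auto
    finally show "(norm w)\<^sup>2 / 2 \<le> B ^ 3" using zero_le_power2[of "norm w"] by linarith
  qed (use b B in auto)
  finally show ?thesis by (simp add: k_def power_divide mult_ac)
qed

lemma summable_inverse_Suc_squares: "summable (\<lambda>j. C * (1 / (real (Suc j))\<^sup>2))"
proof -
  have "summable (\<lambda>j. 1 / (real (Suc j))\<^sup>2)"
    using inverse_squares_sums by (simp add: sums_iff add.commute)
  thus ?thesis by (rule summable_mult)
qed

lemma eventually_ge_Suc: "\<forall>\<^sub>F j in sequentially. C \<le> real (Suc j)"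
  using eventually_ge_at_top[of "nat \<lceil>C\<rceil>"] by eventually_elim linarith

lemma uniform_limit_barnes:
  "uniform_limit (cball 0 B) (\<lambda>N w. \<Sum>j<N. barnes_term j w) (\<lambda>w. \<Sum>j. barnes_term j w) sequentially"
proof (rule Weierstrass_m_test_ev)
  define B' where "B' = max 1 B"
  show "\<forall>\<^sub>F j in sequentially. \<forall>w\<in>cball 0 B. norm (barnes_term j w) \<le> 2 * B' ^ 3 * (1 / (real (Suc j))\<^sup>2)"
    using eventually_ge_Suc[of "2 * B'"]
    by eventually_elim (intro ballI norm_barnes_term_le, auto simp: B'_def)
qed (rule summable_inverse_Suc_squares)

lemma summable_barnes_term: "summable (\<lambda>j. barnes_term j w)"
proof -
  define B where "B = max 1 (norm w)"
  show ?thesis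
  proof (rule summable_comparison_test_ev[OF _ summable_inverse_Suc_squares])
    show "\<forall>\<^sub>F j in sequentially. norm (barnes_term j w) \<le> 2 * B ^ 3 * (1 / (real (Suc j))\<^sup>2)"
      using eventually_ge_Suc[of "2 * B"]
      by eventually_elim (intro norm_barnes_term_le, auto simp: B_def)
  qed
qed

lemma open_Re_gt_minus_1: "open {w. Re w > - 1}" by (rule open_halfspace_Re_gt)

lemma one_plus_div_not_nonpos:
  assumes "Re w > - 1" shows "1 + w / of_nat (Suc j) \<notin> \<real>\<^sub>\<le>\<^sub>0"
proof -
  have "Re (w / of_nat (Suc j)) = Re w / real (Suc j)"
    by (metis Re_divide_of_nat)
  moreover have "Re w / real (Suc j) > - 1"
    using assms by (simp add: field_simps)
  ultimately show ?thesis by (auto simp: complex_nonpos_Reals_iff)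
qed

lemma holomorphic_barnes_term: "barnes_term j holomorphic_on {w. Re w > - 1}"
  unfolding barnes_term_def using one_plus_div_not_nonpos
  by (intro holomorphic_intros) auto

lemma holomorphic_log_barnes: "log_barnes holomorphic_on {w. Re w > - 1}"
proof -
  have "(\<lambda>w. \<Sum>j. barnes_term j w) holomorphic_on {w. Re w > - 1}"
  proof (rule holomorphic_uniform_sequence[OF open_Re_gt_minus_1])
    show "(\<lambda>w. \<Sum>j<N. barnes_term j w) holomorphic_on {w. Re w > - 1}" for N
      using holomorphic_barnes_term by (intro holomorphic_on_sum) auto
    fix x :: complex assume x: "x \<in> {w. Re w > - 1}"
    obtain d where d: "d > 0" "cball x d \<subseteq> {w. Re w > - 1}"
      using open_contains_cball_eq[OF open_Re_gt_minus_1] x by blast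
    have "cball x d \<subseteq> cball 0 (norm x + d)"
    proof
      fix y assume "y \<in> cball x d"
      hence "norm (x - y) \<le> d" by (simp add: dist_norm)
      thus "y \<in> cball 0 (norm x + d)" 
        using norm_triangle_ineq4[of x "x - y"] by simp
    qed
    hence "uniform_limit (cball x d) (\<lambda>N w. \<Sum>j<N. barnes_term j w) (\<lambda>w. \<Sum>j. barnes_term j w) sequentially"
      by (rule uniform_limit_on_subset[OF uniform_limit_barnes])
    with d show "\<exists>d>0. cball x d \<subseteq> {w. Re w > - 1} \<and>
      uniform_limit (cball x d) (\<lambda>N w. \<Sum>j<N. barnes_term j w) (\<lambda>w. \<Sum>j. barnes_term j w) sequentially"
      by blast
  qed
  thus ?thesis unfolding log_barnes_def by (intro holomorphic_intros) auto
qed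

lemma barnes_G_eq_exp:
  assumes w: "Re w > - 1"
  shows "barnes_G (1 + w) = exp (log_barnes w)"
proof -
  have nz: "1 + w / of_nat (Suc j) \<noteq> 0" for j
    using one_plus_div_not_nonpos[OF w, of j] by (metis nonpos_Reals_zero_I)
  have factor: "(1 + w / of_nat (Suc j)) ^ Suc j * (1 + 1 / of_nat (Suc j)) powr (w\<^sup>2 / 2) * exp (- w)
      = exp (barnes_term j w)" for j
  proof -
    have eq: "1 + 1 / (of_nat (Suc j) :: complex) = of_real (1 + 1 / real (Suc j))" by simp
    have pos: "0 < 1 + 1 / real (Suc j)" by (simp add: add_pos_nonneg)
    have l: "ln (1 + 1 / (of_nat (Suc j) :: complex)) = of_real (ln (1 + 1 / real (Suc j)))"
      unfolding eq by (rule Ln_of_real[OF pos])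
    have n: "1 + 1 / (of_nat (Suc j) :: complex) \<noteq> 0"
      unfolding eq of_real_eq_0_iff using pos by linarith
    have "(1 + w / of_nat (Suc j)) ^ Suc j = exp (of_nat (Suc j) * ln (1 + w / of_nat (Suc j)))"
      unfolding exp_of_nat_mult exp_Ln[OF nz] ..
    moreover have "(1 + 1 / of_nat (Suc j)) powr (w\<^sup>2 / 2) = exp (w\<^sup>2 / 2 * of_real (ln (1 + 1 / real (Suc j))))"
      using n l by (simp add: powr_def)
    ultimately show ?thesis
      unfolding barnes_term_def by (simp only: exp_add exp_diff) (simp add: exp_minus field_simps)
  qed
  have p: "of_real (2 * pi) powr (w / 2) = exp (w / 2 * of_real (ln (2 * pi)))"
  proof -
    have "ln (complex_of_real (2 * pi)) = of_real (ln (2 * pi))"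
      by (rule Ln_of_real) simp
    thus ?thesis unfolding powr_def by simp
  qed
  have "barnes_G (1 + w) = of_real (2 * pi) powr (w / 2) * exp (- (w + 1) * w / 2) * (\<Prod>j. exp (barnes_term j w))"
    unfolding barnes_G_def Let_def factor[symmetric] by simp
  also have "(\<Prod>j. exp (barnes_term j w)) = exp (\<Sum>j. barnes_term j w)"
    by (rule prodinf_exp[OF summable_barnes_term])
  also have "of_real (2 * pi) powr (w / 2) * exp (- (w + 1) * w / 2) * exp (\<Sum>j. barnes_term j w)
     = exp (log_barnes w)"
  proof -
    have "w / 2 * of_real (ln (2 * pi)) + - (w + 1) * w / 2 + (\<Sum>j. barnes_term j w) = log_barnes w"
      by (simp add: log_barnes_def) (simp add: algebra_simps)
    thus ?thesis unfolding p exp_add[symmetric] by (rule arg_cong)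
  qed
  finally show ?thesis .
qed

text \<open>
  This is Gauss's limit formula for \<open>ln_Gamma\<close> at \<open>1 + w\<close>. The factors there are \<open>1 + (1 + w) / k\<close>;
  dividing each by \<open>(k + 1) / k\<close> gives \<open>1 + w / (k + 1)\<close>, and the quotients telescope.
\<close>

lemma Gamma_tail_tendsto:
  assumes w: "Re w > - 1"
  shows "(\<lambda>N. Gamma_tail N w) \<longlonglongrightarrow> 0"
proof -
  have ln_rat: "ln ((1 + w) / of_nat (Suc k) + 1) = ln (1 + w / of_nat (Suc (Suc k)))
      + of_real (ln (real (Suc (Suc k))) - ln (real (Suc k)))" for k
  proof -
    have pos: "0 < real (Suc (Suc k)) / real (Suc k)" by simp
    have "(1 + w) / of_nat (Suc k) + 1
        = of_real (real (Suc (Suc k)) / real (Suc k)) * (1 + w / of_nat (Suc (Suc k)))"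
      by (simp add: field_simps del: of_nat_Suc) (simp add: algebra_simps)
    moreover have "1 + w / of_nat (Suc (Suc k)) \<noteq> 0"
      using one_plus_div_not_nonpos[OF w, of "Suc k"] by (metis nonpos_Reals_zero_I)
    ultimately have "ln ((1 + w) / of_nat (Suc k) + 1)
        = of_real (ln (real (Suc (Suc k)) / real (Suc k))) + ln (1 + w / of_nat (Suc (Suc k)))"
      using Ln_times_of_real[OF pos] Ln_of_real[OF pos] by (simp only: simp_thms)
    thus ?thesis by (simp add: ln_div del: of_nat_Suc)
  qed
  have ln_sum: "(\<Sum>k=1..n. ln ((1 + w) / of_nat k + 1))
     = log_prod (Suc n) w - ln (1 + w) + of_real (ln (real (Suc n)))" for n
  proof (induction n)
    case 0 thus ?case by (simp add: log_prod_def)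
  next
    case (Suc n)
    have "(\<Sum>k=1..Suc n. ln ((1 + w) / of_nat k + 1))
       = (\<Sum>k=1..n. ln ((1 + w) / of_nat k + 1)) + ln ((1 + w) / of_nat (Suc n) + 1)"
      by simp
    thus ?case unfolding Suc.IH ln_rat
      by (simp add: log_prod_def del: of_nat_Suc)
  qed
  have series: "ln_Gamma_series (1 + w) (Suc n)
      = of_real (ln (real (Suc n))) + w * of_real (ln (real (Suc n))) - log_prod (Suc (Suc n)) w - of_real (ln (real (Suc (Suc n))))" for n
  proof -
    have "ln (of_nat (Suc n)) = complex_of_real (ln (real (Suc n)))"
      by (metis Ln_of_real of_nat_0_less_iff of_real_of_nat_eq zero_less_Suc)
    thus ?thesis unfolding ln_Gamma_series_def ln_sum by (simp add: algebra_simps del: of_nat_Suc)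
  qed
  have "1 + w \<notin> \<int>\<^sub>\<le>\<^sub>0"
    using w by (auto elim!: nonpos_Ints_cases simp: complex_eq_iff)
  hence "ln_Gamma_series (1 + w) \<longlonglongrightarrow> ln_Gamma (1 + w)"
    by (rule ln_Gamma_complex_LIMSEQ)
  hence L: "(\<lambda>n. ln_Gamma_series (1 + w) (Suc n)) \<longlonglongrightarrow> ln_Gamma (1 + w)"
    by (rule LIMSEQ_Suc)
  have r: "(\<lambda>n. ln (real (Suc n)) - ln (real (Suc (Suc n)))) \<longlonglongrightarrow> 0" 
          "(\<lambda>n. ln (real (Suc n)) - ln (real (Suc (Suc (Suc n))))) \<longlonglongrightarrow> 0"
    by real_asymp+
  have "(\<lambda>n. ln_Gamma (1 + w) - ln_Gamma_series (1 + w) (Suc n)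
       + of_real (ln (real (Suc n)) - ln (real (Suc (Suc n)))) 
       + w * of_real (ln (real (Suc n)) - ln (real (Suc (Suc (Suc n)))))) \<longlonglongrightarrow> ln_Gamma (1 + w) - ln_Gamma (1 + w) + of_real 0 + w * of_real 0"
    by (intro tendsto_intros L r)
  also have "(\<lambda>n. ln_Gamma (1 + w) - ln_Gamma_series (1 + w) (Suc n)
       + of_real (ln (real (Suc n)) - ln (real (Suc (Suc n)))) 
       + w * of_real (ln (real (Suc n)) - ln (real (Suc (Suc (Suc n))))))
     = (\<lambda>n. Gamma_tail (Suc (Suc n)) w)"
    unfolding series Gamma_tail_def by (simp add: algebra_simps fun_eq_iff del: of_nat_Suc)
  finally have "(\<lambda>n. Gamma_tail (n + 2) w) \<longlonglongrightarrow> 0" by simp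
  thus ?thesis by (rule LIMSEQ_offset)
qed

text \<open>
  Summing the increments from \<open>N\<close> to infinity; \<open>B\<close> is a majorant in telescoped form.
\<close>

lemma norm_le_of_telescoping:
  fixes f :: "nat \<Rightarrow> 'a :: real_normed_vector" and B :: "nat \<Rightarrow> real"
  assumes lim: "f \<longlonglongrightarrow> 0" and B: "\<And>n. B n \<ge> 0"
    and step: "\<And>n. n \<ge> N \<Longrightarrow> norm (f n - f (Suc n)) \<le> B n - B (Suc n)"
  shows "norm (f N) \<le> B N"
proof -
  have "norm (f N) \<le> B N + norm (f (N + k)) - B (N + k)" for k
  proof (induction k)
    case (Suc k)
    have "norm (f (N + k)) \<le> norm (f (N + Suc k)) + norm (f (N + k) - f (Suc (N + k)))"
      using norm_triangle_sub[of "f (N + k)" "f (Suc (N + k))"] by simp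
    also have "\<dots> \<le> norm (f (N + Suc k)) + (B (N + k) - B (N + Suc k))"
      using step[of "N + k"] by simp
    finally show ?case using Suc.IH by simp
  qed simp
  hence "norm (f N) \<le> B N + norm (f (k + N))" for k
    using B[of "N + k"] by (smt (verit) add.commute)
  moreover have "(\<lambda>k. B N + norm (f (k + N))) \<longlonglongrightarrow> B N + 0"
    by (intro tendsto_intros LIMSEQ_ignore_initial_segment tendsto_norm_zero lim)
  ultimately show ?thesis
    using tendsto_lowerbound[of "\<lambda>k. B N + norm (f (k + N))" "B N + 0" sequentially "norm (f N)"] by simp
qed

text \<open>
  With \<open>k = Suc n\<close>, the tail loses \<open>w * ln (1 + 1 / k) - ln (1 + w / k)\<close> in each step, which is
  \<open>(w\<^sup>2 - w) / (2 * k\<^sup>2)\<close> up to \<open>O(1 / k\<^sup>3)\<close>. The comparison term loses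
  \<open>(w\<^sup>2 - w) / 2 * (1 / k - 1 / (k + 1))\<close>, the same up to \<open>O(1 / k\<^sup>3)\<close>, and \<open>1 / k\<^sup>3\<close> is at most
  \<open>1 / (k - 1)\<^sup>2 - 1 / k\<^sup>2\<close>.
\<close>

lemma Gamma_tail_approx:
  assumes w: "Re w > - 1" "norm w \<le> B" and B: "1 \<le> B" and N: "2 * B \<le> real N"
  shows "norm (Gamma_tail N w - (w\<^sup>2 - w) / of_nat (2 * Suc N)) \<le> 3 * B ^ 3 / (real N)\<^sup>2"
proof -
  define f where "f = (\<lambda>n. Gamma_tail n w - (w\<^sup>2 - w) / of_nat (2 * Suc n))"
  have lim: "f \<longlonglongrightarrow> 0"
  proof -
    have "(\<lambda>n. 1 / real (2 * Suc n)) \<longlonglongrightarrow> 0" by real_asymp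
    hence "(\<lambda>n. Gamma_tail n w - (w\<^sup>2 - w) * of_real (1 / real (2 * Suc n))) \<longlonglongrightarrow> 0 - (w\<^sup>2 - w) * of_real 0"
      by (intro tendsto_intros Gamma_tail_tendsto w)
    thus ?thesis by (simp add: f_def)
  qed
  have "norm (f N) \<le> 3 * B ^ 3 / (real N)\<^sup>2"
  proof (rule norm_le_of_telescoping[OF lim])
    fix n assume n: "n \<ge> N"
    define k where "k = real (Suc n)"
    have k: "k \<ge> 2" "2 * B \<le> k" using B N n by (auto simp: k_def)
    define a where "a = ln (1 + w / of_real k) - w / of_real k + w\<^sup>2 / of_real (2 * k\<^sup>2)"
    define b where "b = ln (1 + 1 / k) - 1 / k + (1 / k)\<^sup>2 / 2"
    have a: "norm a \<le> B ^ 3 / k ^ 3"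
      unfolding a_def using w k by (intro ln_1_plus_div_approx) auto
    have b: "\<bar>b\<bar> \<le> (1 / k) ^ 3"
      unfolding b_def using k by (intro ln_1_plus_real_approx) auto
    have lnk: "ln (1 + 1 / k) = ln (k + 1) - ln k"
    proof -
      have "1 + 1 / k = (k + 1) / k" using k by (simp add: field_simps)
      thus ?thesis using k by (simp add: ln_div)
    qed
    have kc: "of_nat (Suc n) = complex_of_real k" "of_nat (2 * Suc n) = complex_of_real (2 * k)"
      "of_nat (2 * Suc (Suc n)) = complex_of_real (2 * (k + 1))" "real (Suc (Suc n)) = k + 1" 
      by (simp_all add: k_def)
    have "f n - f (Suc n) = w * of_real (ln (k + 1) - ln k) - ln (1 + w / of_real k)
        - (w\<^sup>2 - w) * of_real (1 / (2 * k) - 1 / (2 * (k + 1)))"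
      unfolding f_def Gamma_tail_def log_prod_def kc k_def[symmetric] 
      by (simp add: kc k_def[symmetric] algebra_simps del: of_nat_Suc)
    also have "\<dots> = w * of_real b - a + (w\<^sup>2 - w) * of_real (1 / (2 * k\<^sup>2) - (1 / (2 * k) - 1 / (2 * (k + 1))))"
      unfolding lnk[symmetric] a_def b_def 
      by (simp add: algebra_simps power_divide diff_divide_distrib power2_eq_square)
    also have "1 / (2 * k\<^sup>2) - (1 / (2 * k) - 1 / (2 * (k + 1))) = 1 / (2 * k\<^sup>2 * (k + 1))"
      using k by (simp add: divide_simps power2_eq_square)
    finally have "norm (f n - f (Suc n)) \<le> norm (w * of_real b) + norm a + norm ((w\<^sup>2 - w) * of_real (1 / (2 * k\<^sup>2 * (k + 1))))"
      by (metis (no_types, lifting) norm_triangle_ineq4 norm_triangle_mono order_refl)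
    also have "norm (w * of_real b) \<le> B ^ 3 * (1 / k) ^ 3"
    proof -
      have "B * 1 \<le> B * B\<^sup>2" using B by (intro mult_left_mono) auto
      hence "norm w \<le> B ^ 3" using w by (simp add: power3_eq_cube power2_eq_square)
      thus ?thesis unfolding norm_mult norm_of_real using b B by (intro mult_mono) auto
    qed
    also have "norm ((w\<^sup>2 - w) * of_real (1 / (2 * k\<^sup>2 * (k + 1)))) \<le> (2 * B ^ 3) * (1 / (2 * k ^ 3))"
    proof -
      have "norm (w\<^sup>2 - w) \<le> norm w ^ 2 + norm w"
        using norm_triangle_ineq4[of "w\<^sup>2" w] by (simp add: norm_power)
      also have "\<dots> \<le> B ^ 2 + B" using w by (intro add_mono power_mono) auto
      also have "\<dots> \<le> B ^ 3 + B ^ 3" using B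
        using power_increasing[of 2 3 B] power_increasing[of 1 3 B] by simp
      finally have 1: "norm (w\<^sup>2 - w) \<le> 2 * B ^ 3" by simp
      have 2: "1 / (2 * k\<^sup>2 * (k + 1)) \<le> 1 / (2 * k ^ 3)"
        using k by (intro divide_left_mono mult_pos_pos) (auto simp: power3_eq_cube power2_eq_square algebra_simps)
      have "norm (complex_of_real (1 / (2 * k\<^sup>2 * (k + 1)))) = 1 / (2 * k\<^sup>2 * (k + 1))"
        using k by (simp only: norm_of_real) simp
      thus ?thesis unfolding norm_mult using 1 2 k B by (intro mult_mono) auto
    qed
    also have "norm a \<le> B ^ 3 / k ^ 3" by (rule a)
    also have "B ^ 3 * (1 / k) ^ 3 + B ^ 3 / k ^ 3 + (2 * B ^ 3) * (1 / (2 * k ^ 3)) = 3 * B ^ 3 * (1 / k ^ 3)"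
      by (simp add: power_divide)
    also have "\<dots> \<le> 3 * B ^ 3 * (1 / (k - 1)\<^sup>2 - 1 / k\<^sup>2)"
    proof (rule mult_left_mono)
      have ne: "k \<noteq> 0" "k - 1 \<noteq> 0" using k by auto
      have "1 / (k - 1)\<^sup>2 - 1 / k\<^sup>2 = (k\<^sup>2 - (k - 1)\<^sup>2) / ((k - 1)\<^sup>2 * k\<^sup>2)"
        using ne by (simp add: diff_frac_eq)
      also have "k\<^sup>2 - (k - 1)\<^sup>2 = 2 * k - 1" by (simp add: power2_eq_square algebra_simps)
      also have "(2 * k - 1) / ((k - 1)\<^sup>2 * k\<^sup>2) = (2 * k - 1) * k / ((k - 1)\<^sup>2 * k ^ 3)"
        using ne by (simp add: power2_eq_square power3_eq_cube)
      also have "\<dots> \<ge> (k - 1)\<^sup>2 / ((k - 1)\<^sup>2 * k ^ 3)"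
      proof (rule divide_right_mono)
        have "(2 * k - 1) * k - (k - 1)\<^sup>2 = k * k + k - 1" by (simp add: algebra_simps power2_eq_square)
        thus "(k - 1)\<^sup>2 \<le> (2 * k - 1) * k" using k by (smt (verit) mult_nonneg_nonneg)
      qed (use k in auto)
      also have "(k - 1)\<^sup>2 / ((k - 1)\<^sup>2 * k ^ 3) = 1 / k ^ 3" using k by simp
      finally show "1 / k ^ 3 \<le> 1 / (k - 1)\<^sup>2 - 1 / k\<^sup>2" .
    qed (use B in auto)
    finally show "norm (f n - f (Suc n)) \<le> 3 * B ^ 3 / (real n)\<^sup>2 - 3 * B ^ 3 / (real (Suc n))\<^sup>2"
      by (simp add: k_def algebra_simps)
  qed (use B in auto)
  thus ?thesis by (simp add: f_def)
qed

section \<open>Asymptotics of the logarithm\<close>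

text \<open>
  The logarithm of the exact formula for the Mellin transform; see \<open>GUE_moment_eq_exp_log_moment\<close>.
  The subtracted values at \<open>- 1 / 2\<close> and \<open>1 / 2\<close> are those of \<open>s = 0\<close>.
\<close>

definition log_moment :: "nat \<Rightarrow> complex \<Rightarrow> complex" where
  "log_moment n s = (let w = (s - 1) / 2; N = n div 2 in
     of_nat n * (s / 2 * of_real (ln 2) + ln_Gamma (1 + w) - ln_Gamma (1 / 2))
     + of_nat (n + 1) * (log_prod N w - log_prod N (- 1 / 2))
     - 2 * (log_wprod N w - log_wprod N (- 1 / 2)))"

text \<open>
  The logarithm defining the function \<open>\<Upsilon>\<close>; see \<open>Upsilon_H_eq\<close>.
\<close>

definition log_limit :: "complex \<Rightarrow> complex" where
  "log_limit s = - (ln_Gamma (1 + (s - 1) / 2) - ln_Gamma (1 / 2))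
     - 2 * (log_barnes ((s - 1) / 2) - log_barnes (- 1 / 2))"

lemma log_wprod_eq:
  "log_wprod N w = (\<Sum>j<N. barnes_term j w) - w\<^sup>2 / 2 * of_real (ln (real (Suc N))) + of_nat N * w"
proof (induction N)
  case (Suc N)
  have "1 + 1 / real (Suc N) = real (Suc (Suc N)) / real (Suc N)" by (simp add: field_simps)
  hence "ln (1 + 1 / real (Suc N)) = ln (real (Suc (Suc N))) - ln (real (Suc N))"
    by (simp add: ln_div del: of_nat_Suc)
  hence ln_Suc: "ln (real (Suc (Suc N))) = ln (real (Suc N)) + ln (1 + 1 / real (Suc N))" by simp
  have step: "log_wprod (Suc N) w = log_wprod N w + of_nat (Suc N) * ln (1 + w / of_nat (Suc N))"
    by (simp add: log_wprod_def)
  have "of_nat (Suc N) * w = of_nat N * w + w" by (simp add: algebra_simps)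
  thus ?case unfolding ln_Suc step Suc.IH sum.lessThan_Suc of_real_add
    by (simp only: barnes_term_def) (simp only: ring_distribs add_ac diff_conv_add_uminus minus_add_distrib minus_minus add_minus_cancel minus_add_cancel)
qed (simp add: log_wprod_def)

text \<open>
  The algebra of \<open>log_moment_error\<close> with all transcendental quantities replaced by variables. It is
  linear in \<open>d\<close>, which stands for \<open>1 / (2 * N + 2)\<close>, and the coefficients of \<open>d\<close> cancel because
  \<open>w\<^sup>2 - w - 3 / 4 = s\<^sup>2 / 4 - s\<close>.
\<close>

lemma log_moment_error_identity:
  fixes n N r d lN ln2 lnn c G G0 P P0 Q Q0 V V0 U U0 w s lpi T T0 LG LG0 mu :: complex
  assumes "w = (s - 1) / 2" "T = G + P - w * lN" "T0 = G0 + P0 - (- 1 / 2) * lN"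
    and "Q = V - w\<^sup>2 / 2 * lN + N * w" "Q0 = V0 - (- 1 / 2)\<^sup>2 / 2 * lN + N * (- 1 / 2)"
    and "lN = lnn - ln2 + c" "r = 2 * N + 2 - n"
    and "LG = w / 2 * lpi - (w + 1) * w / 2 + U"
    and "LG0 = (- 1 / 2) / 2 * lpi - (- 1 / 2 + 1) * (- 1 / 2) / 2 + U0"
    and "mu = lpi / 2 - n / 2 + n / 2 * lnn"
  shows "n * (s / 2 * ln2 + G - G0) + (n + 1) * (P - P0) - 2 * (Q - Q0)
     - (s * mu + s\<^sup>2 / 4 * (lnn - ln2) + (- (G - G0) - 2 * (LG - LG0)))
     = (n + 1) * ((T - (w\<^sup>2 - w) * d) - (T0 - ((- 1 / 2)\<^sup>2 - (- 1 / 2)) * d))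
       - 2 * ((V - U) - (V0 - U0)) + s * (n / 2 * c - r / 2) + s\<^sup>2 / 4 * c
       + (s\<^sup>2 / 4 - s) * ((n + 1) * d - 1)"
  unfolding assms by (simp add: field_simps power2_eq_square)

text \<open>
  The exact error. The parity of \<open>n\<close> enters only through \<open>r\<close>, which is \<open>2\<close> for even and \<open>1\<close> for
  odd \<open>n\<close>: it measures the difference between \<open>ln (N + 1)\<close> and \<open>ln (n / 2)\<close>.
\<close>

lemma log_moment_error:
  fixes n :: nat
  assumes n: "n \<ge> 1"
  defines "N \<equiv> n div 2"
  defines "r \<equiv> 2 * real N + 2 - real n"
  defines "A \<equiv> \<lambda>w. Gamma_tail N w - (w\<^sup>2 - w) / of_nat (2 * Suc N)"
  defines "U \<equiv> \<lambda>w. (\<Sum>j<N. barnes_term j w) - (\<Sum>j. barnes_term j w)"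
  shows "log_moment n s - (s * of_real (mu_H n) + s\<^sup>2 / 4 * of_real (ln (real n / 2)) + log_limit s)
    = of_nat (n + 1) * (A ((s - 1) / 2) - A (- 1 / 2)) - 2 * (U ((s - 1) / 2) - U (- 1 / 2))
      + s * of_real (real n / 2 * ln (1 + r / real n) - r / 2) + s\<^sup>2 / 4 * of_real (ln (1 + r / real n))
      + (s\<^sup>2 / 4 - s) * of_real (real (n + 1) / real (2 * Suc N) - 1)"
proof -
  have "1 + r / real n = 2 * real (Suc N) / real n"
    using n by (simp add: r_def field_simps)
  moreover have "ln (2 * real (Suc N) / real n) = ln 2 + ln (real (Suc N)) - ln (real n)"
    using n by (simp add: ln_div ln_mult del: of_nat_Suc)
  ultimately have lN: "ln (real (Suc N)) = ln (real n) - ln 2 + ln (1 + r / real n)" by simp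
  have ln2: "ln (real n / 2) = ln (real n) - ln 2" using n by (simp add: ln_div)
  have "log_moment n s - (s * of_real (mu_H n) + s\<^sup>2 / 4 * (of_real (ln (real n)) - of_real (ln 2)) + log_limit s)
    = (of_nat n + 1) * ((Gamma_tail N ((s - 1) / 2) - (((s - 1) / 2)\<^sup>2 - (s - 1) / 2) * (1 / of_nat (2 * Suc N)))
          - (Gamma_tail N (- 1 / 2) - ((- 1 / 2)\<^sup>2 - (- 1 / 2)) * (1 / of_nat (2 * Suc N))))
      - 2 * (U ((s - 1) / 2) - U (- 1 / 2))
      + s * (of_nat n / 2 * of_real (ln (1 + r / real n)) - of_real r / 2) + s\<^sup>2 / 4 * of_real (ln (1 + r / real n))
      + (s\<^sup>2 / 4 - s) * ((of_nat n + 1) * (1 / of_nat (2 * Suc N)) - 1)"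
    unfolding log_moment_def Let_def N_def[symmetric] log_limit_def of_nat_add of_nat_1 U_def
  proof (rule log_moment_error_identity)
    show "Gamma_tail N ((s - 1) / 2) = ln_Gamma (1 + (s - 1) / 2) + log_prod N ((s - 1) / 2)
        - (s - 1) / 2 * of_real (ln (real (Suc N)))"
      by (simp add: Gamma_tail_def)
    show "Gamma_tail N (- 1 / 2) = ln_Gamma (1 / 2) + log_prod N (- 1 / 2)
        - (- 1 / 2) * of_real (ln (real (Suc N)))"
      by (simp add: Gamma_tail_def)
    show "complex_of_real (ln (real (Suc N))) = of_real (ln (real n)) - of_real (ln 2) + of_real (ln (1 + r / real n))"
      using lN by (metis of_real_add of_real_diff)
  qed (rule refl log_wprod_eq log_barnes_def | simp add: r_def mu_H_def)+
  thus ?thesis unfolding ln2 A_def by (simp add: add.commute)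
qed

text \<open>
  Each summand of \<open>log_moment_error\<close> tends to \<open>0\<close>: the first is \<open>O(n / N\<^sup>2)\<close> by
  \<open>Gamma_tail_approx\<close>, the second is a tail of the uniformly convergent series for \<open>G\<close>, and the
  others are functions bounded on \<open>K\<close> times real null sequences.
\<close>

lemma log_moment_asymptotics:
  assumes K: "compact K" "K \<subseteq> S1"
  shows "uniform_limit K
    (\<lambda>n s. log_moment n s - (s * of_real (mu_H n) + s\<^sup>2 / 4 * of_real (ln (real n / 2)) + log_limit s))
    (\<lambda>_. 0) sequentially"
proof -
  obtain C where C: "\<And>s. s \<in> K \<Longrightarrow> norm s \<le> C"
    using compact_imp_bounded[OF K(1)] unfolding bounded_iff by blast
  define B where "B = max 1 C + 1"
  have B: "1 \<le> B" by (simp add: B_def)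
  have nB: "norm s \<le> B" "norm ((s - 1) / 2) \<le> B" "Re ((s - 1) / 2) > - 1" if "s \<in> K" for s
  proof -
    have s: "norm s \<le> C" using C that by blast
    thus "norm s \<le> B" by (simp add: B_def)
    have "norm ((s - 1) / 2) \<le> norm (s - 1)" by (simp add: norm_divide)
    also have "\<dots> \<le> norm s + 1" using norm_triangle_ineq4[of s 1] by simp
    finally show "norm ((s - 1) / 2) \<le> B" using s by (simp add: B_def)
    show "Re ((s - 1) / 2) > - 1" using that K(2) by (auto simp: S1_def)
  qed
  have half: "norm (- 1 / 2 :: complex) \<le> B" "Re (- 1 / 2 :: complex) > - 1"
    using B by (simp_all add: norm_divide)
  define A where "A = (\<lambda>n w. Gamma_tail (n div 2) w - (w\<^sup>2 - w) / of_nat (2 * Suc (n div 2)))"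
  define U where "U = (\<lambda>n w. (\<Sum>j<n div 2. barnes_term j w) - (\<Sum>j. barnes_term j w))"
  define r where "r = (\<lambda>n. 2 * real (n div 2) + 2 - real n)"
  have r: "1 \<le> r n" "r n \<le> 2" for n unfolding r_def by linarith+
  have div2: "filterlim (\<lambda>n::nat. n div 2) sequentially sequentially"
    by (rule filterlim_at_top_div_const_nat) simp
  have to0: "uniform_limit K (\<lambda>n s. f n s * of_real (a n)) (\<lambda>_. 0) sequentially"
    if f: "\<And>n s. s \<in> K \<Longrightarrow> norm (f n s) \<le> D" and a: "a \<longlonglongrightarrow> 0"
    for f :: "nat \<Rightarrow> complex \<Rightarrow> complex" and a :: "nat \<Rightarrow> real" and D
  proof (rule uniform_limitI)
    fix e :: real assume e: "e > 0"
    have D: "\<bar>D\<bar> + 1 > 0" by simp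
    have "\<forall>\<^sub>F n in sequentially. dist (a n) 0 < e / (\<bar>D\<bar> + 1)"
      using e D by (intro tendstoD[OF a]) simp
    thus "\<forall>\<^sub>F n in sequentially. \<forall>s\<in>K. dist (f n s * of_real (a n)) 0 < e"
    proof (eventually_elim, safe)
      fix n s assume a: "dist (a n) 0 < e / (\<bar>D\<bar> + 1)" and s: "s \<in> K"
      have "norm (f n s * of_real (a n)) \<le> (\<bar>D\<bar> + 1) * \<bar>a n\<bar>"
        using f[OF s, of n] by (auto simp: norm_mult intro!: mult_right_mono)
      also have "\<dots> < e" using a D by (simp add: pos_less_divide_eq mult.commute)
      finally show "dist (f n s * of_real (a n)) 0 < e" by simp
    qed
  qed
  have bound0: "uniform_limit K f (\<lambda>_. 0) sequentially"
    if "\<forall>\<^sub>F n in sequentially. \<forall>s\<in>K. norm (f n s) \<le> a n" and a: "a \<longlonglongrightarrow> 0"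
    for f :: "nat \<Rightarrow> complex \<Rightarrow> complex" and a :: "nat \<Rightarrow> real"
  proof (rule uniform_limitI)
    fix e :: real assume e: "e > 0"
    show "\<forall>\<^sub>F n in sequentially. \<forall>s\<in>K. dist (f n s) 0 < e"
      using that(1) tendstoD[OF a e] by eventually_elim force
  qed
  have limA: "uniform_limit K (\<lambda>n s. of_nat (n + 1) * (A n ((s - 1) / 2) - A n (- 1 / 2))) (\<lambda>_. 0) sequentially"
  proof (rule bound0)
    have "\<forall>\<^sub>F n in sequentially. 2 * B \<le> real (n div 2)"
    proof -
      have "\<forall>\<^sub>F N in sequentially. 2 * B \<le> real N" by real_asymp
      thus ?thesis by (rule eventually_compose_filterlim[OF _ div2])
    qed
    thus "\<forall>\<^sub>F n in sequentially. \<forall>s\<in>K. norm (of_nat (n + 1) * (A n ((s - 1) / 2) - A n (- 1 / 2)))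
        \<le> 6 * B ^ 3 * (real (n + 1) / (real (n div 2))\<^sup>2)"
    proof (eventually_elim, safe)
      fix n s assume n: "2 * B \<le> real (n div 2)" and s: "s \<in> K"
      have "norm (A n w) \<le> 3 * B ^ 3 / (real (n div 2))\<^sup>2" if "Re w > - 1" "norm w \<le> B" for w
        unfolding A_def using that B n by (rule Gamma_tail_approx)
      from this[OF nB(3,2)[OF s]] this[OF half(2,1)]
      have "norm (A n ((s - 1) / 2) - A n (- 1 / 2)) \<le> 6 * B ^ 3 / (real (n div 2))\<^sup>2"
        using norm_triangle_ineq4[of "A n ((s - 1) / 2)" "A n (- 1 / 2)"] by linarith
      hence "real (n + 1) * norm (A n ((s - 1) / 2) - A n (- 1 / 2))
          \<le> real (n + 1) * (6 * B ^ 3 / (real (n div 2))\<^sup>2)"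
        by (rule mult_left_mono) simp
      thus "norm (of_nat (n + 1) * (A n ((s - 1) / 2) - A n (- 1 / 2)))
        \<le> 6 * B ^ 3 * (real (n + 1) / (real (n div 2))\<^sup>2)"
        by (simp only: norm_mult norm_of_nat) (simp add: mult_ac)
    qed
    have "(\<lambda>n. real (n + 1) / (real (n div 2))\<^sup>2) \<longlonglongrightarrow> 0"
    proof (rule tendsto_sandwich[of "\<lambda>_. 0" _ _ "\<lambda>n. real (2 * (n div 2) + 2) / (real (n div 2))\<^sup>2"])
      have "(\<lambda>N. real (2 * N + 2) / (real N)\<^sup>2) \<longlonglongrightarrow> 0" by real_asymp
      thus "(\<lambda>n. real (2 * (n div 2) + 2) / (real (n div 2))\<^sup>2) \<longlonglongrightarrow> 0"
        by (rule filterlim_compose[OF _ div2])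
      show "\<forall>\<^sub>F n in sequentially. real (n + 1) / (real (n div 2))\<^sup>2 \<le> real (2 * (n div 2) + 2) / (real (n div 2))\<^sup>2"
        by (intro always_eventually allI divide_right_mono of_nat_mono) auto
    qed auto
    thus "(\<lambda>n. 6 * B ^ 3 * (real (n + 1) / (real (n div 2))\<^sup>2)) \<longlonglongrightarrow> 0"
      by (rule tendsto_mult_right_zero)
  qed
  have limU1: "uniform_limit (cball 0 B) U (\<lambda>_. 0) sequentially"
  proof (rule uniform_limitI)
    fix e :: real assume "e > 0"
    from uniform_limitD[OF uniform_limit_barnes this]
    have "\<forall>\<^sub>F n in sequentially. \<forall>w\<in>cball 0 B.
        dist (\<Sum>j<n div 2. barnes_term j w) (\<Sum>j. barnes_term j w) < e"
      by (rule eventually_compose_filterlim[OF _ div2])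
    thus "\<forall>\<^sub>F n in sequentially. \<forall>w\<in>cball 0 B. dist (U n w) 0 < e"
      by (simp add: U_def dist_norm)
  qed
  have limU: "uniform_limit K (\<lambda>n s. U n ((s - 1) / 2)) (\<lambda>_. 0) sequentially"
    "uniform_limit K (\<lambda>n s. U n (- 1 / 2)) (\<lambda>_. 0) sequentially"
    by (rule uniform_limit_compose'[OF limU1], use nB half in force)+
  have limc: "(\<lambda>n. ln (1 + r n / real n)) \<longlonglongrightarrow> 0"
  proof (rule tendsto_sandwich[of "\<lambda>_. 0" _ _ "\<lambda>n. ln (1 + 2 / real n)"])
    show "\<forall>\<^sub>F n in sequentially. ln (1 + r n / real n) \<le> ln (1 + 2 / real n)"
    proof (intro always_eventually allI)
      fix n
      have "0 \<le> r n / real n" "r n / real n \<le> 2 / real n"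
        using r[of n] by (auto intro!: divide_right_mono)
      thus "ln (1 + r n / real n) \<le> ln (1 + 2 / real n)" by (subst ln_le_cancel_iff) auto
    qed
    show "(\<lambda>n. ln (1 + 2 / real n)) \<longlonglongrightarrow> 0" by real_asymp
    show "\<forall>\<^sub>F n in sequentially. 0 \<le> ln (1 + r n / real n)"
      using r by (intro always_eventually allI ln_ge_zero) (smt (verit) divide_nonneg_nonneg of_nat_0_le_iff)
  qed simp
  have lima: "(\<lambda>n. real n / 2 * ln (1 + r n / real n) - r n / 2) \<longlonglongrightarrow> 0"
  proof (rule Lim_null_comparison)
    show "\<forall>\<^sub>F n in sequentially. norm (real n / 2 * ln (1 + r n / real n) - r n / 2) \<le> 2 / real n"
      using eventually_ge_at_top[of 4]
    proof eventually_elim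
      case (elim n)
      define x where "x = r n / real n"
      have x: "0 \<le> x" "x \<le> 1 / 2" using r[of n] elim by (auto simp: x_def field_simps)
      have eq: "real n / 2 * ln (1 + r n / real n) - r n / 2 = real n / 2 * (ln (1 + x) - x)"
        using elim by (simp add: x_def field_simps)
      have "norm (real n / 2 * ln (1 + r n / real n) - r n / 2) = real n / 2 * \<bar>ln (1 + x) - x\<bar>"
        unfolding eq by (simp add: abs_mult)
      also have "\<dots> \<le> real n / 2 * (2 / real n)\<^sup>2"
      proof (rule mult_left_mono)
        have "\<bar>ln (1 + x) - x\<bar> \<le> x\<^sup>2" using x by (rule ln_1_plus_real_approx)
        also have "\<dots> \<le> (2 / real n)\<^sup>2"
          using r[of n] x by (intro power_mono) (auto simp: x_def intro!: divide_right_mono)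
        finally show "\<bar>ln (1 + x) - x\<bar> \<le> (2 / real n)\<^sup>2" .
      qed auto
      also have "\<dots> = 2 / real n" using elim by (simp add: power2_eq_square)
      finally show ?case .
    qed
    show "(\<lambda>n. 2 / real n) \<longlonglongrightarrow> 0" by real_asymp
  qed
  have limd: "(\<lambda>n. real (n + 1) / real (2 * Suc (n div 2)) - 1) \<longlonglongrightarrow> 0"
  proof (rule Lim_null_comparison)
    show "\<forall>\<^sub>F n in sequentially. norm (real (n + 1) / real (2 * Suc (n div 2)) - 1) \<le> 1 / real (Suc (n div 2))"
    proof (intro always_eventually allI)
      fix n
      have eq: "real (n + 1) / real (2 * Suc (n div 2)) - 1 = (real n + 1 - 2 * real (Suc (n div 2))) / real (2 * Suc (n div 2))"
        by (simp add: field_simps)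
      have "real n \<le> 2 * real (n div 2) + 1" "2 * real (n div 2) \<le> real n" by linarith+
      hence "\<bar>real n + 1 - 2 * real (Suc (n div 2))\<bar> \<le> 2" by (simp add: abs_le_iff)
      hence "\<bar>real n + 1 - 2 * real (Suc (n div 2))\<bar> / real (2 * Suc (n div 2)) \<le> 2 / real (2 * Suc (n div 2))"
        by (rule divide_right_mono) simp
      also have "2 / real (2 * Suc (n div 2)) = 1 / real (Suc (n div 2))"
        by (simp only: of_nat_mult of_nat_numeral) (simp del: of_nat_Suc)
      finally show "norm (real (n + 1) / real (2 * Suc (n div 2)) - 1) \<le> 1 / real (Suc (n div 2))"
        unfolding eq real_norm_def abs_divide abs_of_nat .
    qed
    have "(\<lambda>N. 1 / real (Suc N)) \<longlonglongrightarrow> 0" by real_asymp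
    thus "(\<lambda>n. 1 / real (Suc (n div 2))) \<longlonglongrightarrow> 0" by (rule filterlim_compose[OF _ div2])
  qed
  have norm_s2: "norm (s\<^sup>2 / 4) \<le> B\<^sup>2" "norm (s\<^sup>2 / 4 - s) \<le> B\<^sup>2 + B" if s: "s \<in> K" for s
  proof -
    have "norm (s\<^sup>2 / 4) \<le> (norm s)\<^sup>2" by (simp add: norm_divide norm_power)
    also have "\<dots> \<le> B\<^sup>2" using nB(1)[OF s] by (intro power_mono) auto
    finally show 1: "norm (s\<^sup>2 / 4) \<le> B\<^sup>2" .
    show "norm (s\<^sup>2 / 4 - s) \<le> B\<^sup>2 + B"
      using norm_triangle_ineq4[of "s\<^sup>2 / 4" s] 1 nB(1)[OF s] by linarith
  qed
  have "uniform_limit K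
      (\<lambda>n s. of_nat (n + 1) * (A n ((s - 1) / 2) - A n (- 1 / 2))
        - 2 * (U n ((s - 1) / 2) - U n (- 1 / 2))
        + s * of_real (real n / 2 * ln (1 + r n / real n) - r n / 2)
        + s\<^sup>2 / 4 * of_real (ln (1 + r n / real n))
        + (s\<^sup>2 / 4 - s) * of_real (real (n + 1) / real (2 * Suc (n div 2)) - 1))
      (\<lambda>_. 0 - 2 * (0 - 0) + 0 + 0 + 0) sequentially"
    by (intro uniform_limit_add uniform_limit_minus limA limU to0[OF nB(1) lima] to0[OF norm_s2(1) limc]
        to0[OF norm_s2(2) limd] bounded_linear.uniform_limit[OF bounded_linear_mult_right])
  hence lim: "uniform_limit K
      (\<lambda>n s. of_nat (n + 1) * (A n ((s - 1) / 2) - A n (- 1 / 2))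
        - 2 * (U n ((s - 1) / 2) - U n (- 1 / 2))
        + s * of_real (real n / 2 * ln (1 + r n / real n) - r n / 2)
        + s\<^sup>2 / 4 * of_real (ln (1 + r n / real n))
        + (s\<^sup>2 / 4 - s) * of_real (real (n + 1) / real (2 * Suc (n div 2)) - 1))
      (\<lambda>_. 0) sequentially" by simp
  show ?thesis
  proof (rule uniform_limit_cong[THEN iffD1, OF _ _ lim])
    show "\<forall>\<^sub>F n in sequentially. \<forall>s\<in>K.
       of_nat (n + 1) * (A n ((s - 1) / 2) - A n (- 1 / 2))
        - 2 * (U n ((s - 1) / 2) - U n (- 1 / 2))
        + s * of_real (real n / 2 * ln (1 + r n / real n) - r n / 2)
        + s\<^sup>2 / 4 * of_real (ln (1 + r n / real n))
        + (s\<^sup>2 / 4 - s) * of_real (real (n + 1) / real (2 * Suc (n div 2)) - 1)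
       = log_moment n s - (s * of_real (mu_H n) + s\<^sup>2 / 4 * of_real (ln (real n / 2)) + log_limit s)"
      using eventually_ge_at_top[of 1]
      by eventually_elim (intro ballI, simp only: log_moment_error A_def U_def r_def)
  qed auto
qed

section \<open>The analytic logarithms\<close>

lemma Gamma_eq_exp_ln_Gamma:
  fixes z :: complex
  assumes "Re z > 0"
  shows "Gamma z = exp (ln_Gamma z)"
proof -
  have "z \<notin> \<int>\<^sub>\<le>\<^sub>0" using assms by (auto elim!: nonpos_Ints_cases)
  thus ?thesis by (simp add: Gamma_complex_altdef)
qed

lemma half_moment_ratio:
  assumes s: "Re s > - 1"
  shows "half_moment s / half_moment 0
     = exp (s / 2 * of_real (ln 2) + ln_Gamma (1 + (s - 1) / 2) - ln_Gamma (1 / 2))"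
proof -
  have sw: "(s + 1) / 2 = 1 + (s - 1) / 2" by (simp add: field_simps)
  have "Re (1 + (s - 1) / 2) > 0" using s by (simp add: field_simps)
  hence 1: "Gamma ((s + 1) / 2) = exp (ln_Gamma (1 + (s - 1) / 2))"
    unfolding sw by (rule Gamma_eq_exp_ln_Gamma)
  have 2: "Gamma ((0 + 1) / 2 :: complex) = exp (ln_Gamma (1 / 2))"
    using Gamma_eq_exp_ln_Gamma[of "1 / 2"] by simp
  have arg: "s / 2 * of_real (ln 2) + ln_Gamma (1 + (s - 1) / 2) - ln_Gamma (1 / 2)
      = ((s - 1) / 2 * of_real (ln 2) + ln_Gamma (1 + (s - 1) / 2)) - ((0 - 1) / 2 * of_real (ln 2) + ln_Gamma (1 / 2))"
    by (simp add: field_simps)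
  show ?thesis unfolding half_moment_def 1 2 arg exp_diff exp_add ..
qed

text \<open>
  Only odd indices contribute, and for \<open>2 * j - 1\<close> the ratio is
  \<open>(2 * j - 1 + s) / (2 * j - 1) = (1 + w / j) / (1 - 1 / (2 * j))\<close> with \<open>w = (s - 1) / 2\<close>.
\<close>

lemma hermite_coeff_ratio_prod:
  assumes s: "Re s > - 1"
  shows "(\<Prod>m<k. hermite_coeff s (Suc m) / hermite_coeff 0 (Suc m))
     = exp (log_prod (Suc k div 2) ((s - 1) / 2) - log_prod (Suc k div 2) (- 1 / 2))"
proof (induction k)
  case 0
  show ?case by (simp add: log_prod_def)
next
  case (Suc k)
  show ?case
  proof (cases "even k")
    case False
    hence "Suc (Suc k) div 2 = Suc k div 2" by presburger
    moreover have "hermite_coeff s (Suc k) / hermite_coeff 0 (Suc k) = 1"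
      using False by (simp add: hermite_coeff_def del: of_nat_Suc)
    ultimately show ?thesis using Suc.IH by simp
  next
    case True
    then obtain j where k: "k = 2 * j" by (elim evenE)
    define w where "w = (s - 1) / 2"
    have nz: "1 + w / of_nat (Suc j) \<noteq> 0"
      using one_plus_div_not_nonpos[of w j] s by (auto simp: w_def simp del: of_nat_Suc)
    have nz': "1 + (- 1 / 2) / of_nat (Suc j) \<noteq> (0 :: complex)"
      using one_plus_div_not_nonpos[of "- 1 / 2" j] by (auto simp del: of_nat_Suc)
    have k2: "hermite_coeff t (Suc k) = 2 * of_nat (Suc j) * (1 + ((t - 1) / 2) / of_nat (Suc j))" for t
      by (simp add: k hermite_coeff_def divide_simps del: of_nat_Suc) (simp add: algebra_simps)
    have "hermite_coeff s (Suc k) / hermite_coeff 0 (Suc k)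
        = (1 + w / of_nat (Suc j)) / (1 + (- 1 / 2) / of_nat (Suc j))"
      unfolding k2 w_def by (simp del: of_nat_Suc)
    also have "\<dots> = exp (ln (1 + w / of_nat (Suc j)) - ln (1 + (- 1 / 2) / of_nat (Suc j)))"
      unfolding exp_diff exp_Ln[OF nz] exp_Ln[OF nz'] ..
    finally have ratio: "hermite_coeff s (Suc k) / hermite_coeff 0 (Suc k)
        = exp (ln (1 + w / of_nat (Suc j)) - ln (1 + (- 1 / 2) / of_nat (Suc j)))" .
    have d: "Suc k div 2 = j" "Suc (Suc k) div 2 = Suc j" by (simp_all add: k)
    show ?thesis
      unfolding prod.lessThan_Suc Suc.IH ratio d exp_add[symmetric] w_def[symmetric]
      by (simp add: log_prod_def algebra_simps del: of_nat_Suc)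
  qed
qed

text \<open>
  The logarithm with index \<open>j\<close> occurs for \<open>2 * j - 1 \<le> k < n\<close>, that is \<open>n + 1 - 2 * j\<close> times; the
  part of this multiplicity proportional to \<open>j\<close> is what produces the Barnes function.
\<close>

lemma sum_log_prod:
  "(\<Sum>k<n. log_prod (Suc k div 2) w) = of_nat (n + 1) * log_prod (n div 2) w - 2 * log_wprod (n div 2) w"
proof (induction n)
  case 0
  show ?case by (simp add: log_prod_def log_wprod_def)
next
  case (Suc n)
  show ?case
  proof (cases "even n")
    case True
    hence "Suc n div 2 = n div 2" by presburger
    thus ?thesis using Suc.IH by (simp add: algebra_simps)
  next
    case False
    then obtain N where n: "n = 2 * N + 1" by (elim oddE)
    have d: "Suc n div 2 = Suc N" "n div 2 = N" by (simp_all add: n)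
    define x where "x = ln (1 + w / of_nat (Suc N))"
    have lp: "log_prod (Suc N) w = log_prod N w + x" "log_wprod (Suc N) w = log_wprod N w + of_nat (Suc N) * x"
      by (simp_all add: log_prod_def log_wprod_def x_def)
    show ?thesis using Suc.IH unfolding sum.lessThan_Suc d lp by (simp add: n algebra_simps)
  qed
qed

lemma GUE_moment_eq_exp_log_moment:
  assumes G: "normalized_GUE M n W" and s: "Re s > - 1"
  shows "integral\<^sup>L M (\<lambda>\<omega>. exp (s * of_real (ln (cmod (Determinant.det (W \<omega>)))))) = exp (log_moment n s)"
proof -
  let ?a = "s / 2 * of_real (ln 2) + ln_Gamma (1 + (s - 1) / 2) - ln_Gamma (1 / 2)"
  let ?b = "\<lambda>k. log_prod (Suc k div 2) ((s - 1) / 2) - log_prod (Suc k div 2) (- 1 / 2)"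
  have "(\<Prod>k<n. half_moment s / half_moment 0 * (\<Prod>m<k. hermite_coeff s (Suc m) / hermite_coeff 0 (Suc m)))
      = (\<Prod>k<n. exp (?a + ?b k))"
    unfolding half_moment_ratio[OF s] hermite_coeff_ratio_prod[OF s] exp_add[symmetric] ..
  also have "\<dots> = exp (\<Sum>k<n. ?a + ?b k)" by (rule exp_sum[OF finite_lessThan, symmetric])
  also have "(\<Sum>k<n. ?a + ?b k) = log_moment n s"
    unfolding sum.distrib sum_subtractf sum_log_prod log_moment_def Let_def
    by (simp add: algebra_simps)
  finally show ?thesis unfolding GUE_moment_formula[OF G s] .
qed

lemma connected_S1: "connected S1" and zero_in_S1: "0 \<in> S1"
proof -
  have "S1 = {z. Re z > - 1}" by (simp add: S1_def)
  moreover have "connected {z. Re z > - 1}" by (intro convex_connected convex_halfspace_Re_gt)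
  ultimately show "connected S1" by simp
qed (simp add: S1_def)

lemma shift_S1: "s \<in> S1 \<Longrightarrow> Re ((s - 1) / 2) > - 1"
  by (simp add: S1_def)

lemma holomorphic_ln_Gamma_shift: "(\<lambda>s. ln_Gamma (1 + (s - 1) / 2)) holomorphic_on S1"
proof -
  have hol: "ln_Gamma holomorphic_on {z :: complex. Re z > 0}"
    by (rule holomorphic_ln_Gamma) (auto simp: complex_nonpos_Reals_iff)
  show ?thesis
  proof (rule holomorphic_on_compose_gen[OF _ hol, unfolded o_def])
    show "(\<lambda>s. 1 + (s - 1) / 2) holomorphic_on S1" by (intro holomorphic_intros) auto
    show "(\<lambda>s. 1 + (s - 1) / 2) ` S1 \<subseteq> {z. Re z > 0}"
    proof (intro image_subsetI CollectI)
      fix s assume "s \<in> S1"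
      hence "Re ((s - 1) / 2) > - 1" by (rule shift_S1)
      thus "0 < Re (1 + (s - 1) / 2)" unfolding plus_complex.sel one_complex.sel by linarith
    qed
  qed
qed

lemma analytic_log_GUE_moment:
  assumes G: "normalized_GUE M n W" and z: "z \<in> S1"
  shows "analytic_log S1 (\<lambda>s. integral\<^sup>L M (\<lambda>\<omega>. exp (s * of_real (ln (cmod (Determinant.det (W \<omega>))))))) z
    = log_moment n z"
proof (rule analytic_log_eqI[OF connected_S1 zero_in_S1 _ _ _ z])
  have "1 + (s - 1) / 2 / of_nat (Suc j) \<notin> \<real>\<^sub>\<le>\<^sub>0" if "s \<in> S1" for s j
    using one_plus_div_not_nonpos[OF shift_S1[OF that]] .
  thus "log_moment n holomorphic_on S1"
    unfolding log_moment_def Let_def log_prod_def log_wprod_def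
    by (intro holomorphic_intros holomorphic_ln_Gamma_shift) auto
  show "log_moment n 0 = 0" by (simp add: log_moment_def Let_def)
  show "exp (log_moment n s) = integral\<^sup>L M (\<lambda>\<omega>. exp (s * of_real (ln (cmod (Determinant.det (W \<omega>))))))"
    if "s \<in> S1" for s
    by (rule GUE_moment_eq_exp_log_moment[OF G, symmetric]) (use that in \<open>simp add: S1_def\<close>)
qed

lemma Upsilon_H_eq:
  assumes z: "z \<in> S1"
  shows "Upsilon_H z = log_limit z"
  unfolding Upsilon_H_def
proof (rule analytic_log_eqI[OF connected_S1 zero_in_S1 _ _ _ z])
  have "(\<lambda>s. log_barnes ((s - 1) / 2)) holomorphic_on S1"
  proof (rule holomorphic_on_compose_gen[OF _ holomorphic_log_barnes, unfolded o_def])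
    show "(\<lambda>s. (s - 1) / 2) holomorphic_on S1" by (intro holomorphic_intros) auto
    show "(\<lambda>s. (s - 1) / 2) ` S1 \<subseteq> {w. Re w > - 1}" by (intro image_subsetI CollectI shift_S1)
  qed
  thus "log_limit holomorphic_on S1"
    unfolding log_limit_def
    by (intro holomorphic_on_diff holomorphic_on_minus holomorphic_on_mult holomorphic_on_const
        holomorphic_ln_Gamma_shift)
  show "log_limit 0 = 0" by (simp add: log_limit_def)
  fix s assume s: "s \<in> S1"
  define w where "w = (s - 1) / 2"
  have w: "Re w > - 1" using shift_S1[OF s] by (simp add: w_def)
  have sw: "(s + 1) / 2 = 1 + w" by (simp add: w_def field_simps)
  have "log_limit s = ln_Gamma (1 / 2) - ln_Gamma (1 + w)
      + ((log_barnes (- 1 / 2) + log_barnes (- 1 / 2)) - (log_barnes w + log_barnes w))"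
    unfolding log_limit_def w_def[symmetric] by (simp add: right_diff_distrib)
  hence e: "exp (log_limit s) = exp (ln_Gamma (1 / 2)) / exp (ln_Gamma (1 + w))
      * ((exp (log_barnes (- 1 / 2)))\<^sup>2 / (exp (log_barnes w))\<^sup>2)"
    by (simp only: exp_add exp_diff power2_eq_square)
  have g1: "Gamma ((s + 1) / 2) = exp (ln_Gamma (1 + w))" unfolding sw using w by (intro Gamma_eq_exp_ln_Gamma) simp
  have g2: "Gamma (1 / 2 :: complex) = exp (ln_Gamma (1 / 2))" by (rule Gamma_eq_exp_ln_Gamma) simp
  have g3: "barnes_G ((s + 1) / 2) = exp (log_barnes w)" unfolding sw by (rule barnes_G_eq_exp[OF w])
  have g4: "barnes_G (1 / 2) = exp (log_barnes (- 1 / 2))" using barnes_G_eq_exp[of "- 1 / 2"] by simp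
  show "exp (log_limit s) = Gamma (1 / 2) / Gamma ((s + 1) / 2) * ((barnes_G (1 / 2))\<^sup>2 / (barnes_G ((s + 1) / 2))\<^sup>2)"
    unfolding e g1 g2 g3 g4 ..
qed

theorem lemma4p1:
  fixes M :: "nat \<Rightarrow> 'a measure" and W :: "nat \<Rightarrow> 'a \<Rightarrow> complex mat"
  assumes "\<And>n. n \<ge> 1 \<Longrightarrow> normalized_GUE (M n) n (W n)"
  shows "\<forall>K. compact K \<and> K \<subseteq> S1 \<longrightarrow>
    uniform_limit K
      (\<lambda>n z. analytic_log S1
           (\<lambda>s. integral\<^sup>L (M n)
              (\<lambda>\<omega>. exp (s * of_real (ln (cmod (Determinant.det (W n \<omega>))))))) z
         - (z * of_real (mu_H n) + z\<^sup>2 / 4 * of_real (ln (real n / 2)) + Upsilon_H z))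
      (\<lambda>_. 0) sequentially"
proof (rule allI, rule impI, erule conjE)
  fix K assume K: "compact K" "K \<subseteq> S1"
  define f where "f = (\<lambda>n z. analytic_log S1
           (\<lambda>s. integral\<^sup>L (M n)
              (\<lambda>\<omega>. exp (s * of_real (ln (cmod (Determinant.det (W n \<omega>))))))) z
         - (z * of_real (mu_H n) + z\<^sup>2 / 4 * of_real (ln (real n / 2)) + Upsilon_H z))"
  define g where "g = (\<lambda>n z. log_moment n z
         - (z * of_real (mu_H n) + z\<^sup>2 / 4 * of_real (ln (real n / 2)) + log_limit z))"
  have fg: "\<forall>\<^sub>F n in sequentially. \<forall>z\<in>K. f n z = g n z"
    using eventually_ge_at_top[of 1]
  proof eventually_elim
    case (elim n)
    show ?case
    proof
      fix z assume "z \<in> K"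
      hence z: "z \<in> S1" using K(2) by blast
      show "f n z = g n z"
        unfolding f_def g_def analytic_log_GUE_moment[OF assms[OF elim] z] Upsilon_H_eq[OF z] ..
    qed
  qed
  have "uniform_limit K g (\<lambda>_. 0) sequentially"
    unfolding g_def by (rule log_moment_asymptotics[OF K])
  hence "uniform_limit K f (\<lambda>_. 0) sequentially"
    by (subst uniform_limit_cong[OF fg]) auto
  thus "uniform_limit K
      (\<lambda>n z. analytic_log S1
           (\<lambda>s. integral\<^sup>L (M n)
              (\<lambda>\<omega>. exp (s * of_real (ln (cmod (Determinant.det (W n \<omega>))))))) z
         - (z * of_real (mu_H n) + z\<^sup>2 / 4 * of_real (ln (real n / 2)) + Upsilon_H z))
      (\<lambda>_. 0) sequentially"
    unfolding f_def .
qed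

end
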